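(* The geometric thickness of the complete bipartite graph $K_{6,8}$ is $\overline{\theta}(K_{6,8}) = 3$.
   Context: The geometric thickness $\overline{\theta}(G)$ of a graph $G$ is the smallest integer $k$ such that there is an injective placement of the vertices of $G$ at points of the plane, with each edge drawn as the straight line segment between the points of its endpoints and containing no other vertex point, together with an assignment of each edge to one of $k$ layers, such that no two edges assigned to the same layer cross (i.e., two edges in the same layer meet at most in a common endpoint). *)

theory Defs
  imports "HOL-Analysis.Analysis"
begin

text \<open>A graph is given by a vertex set V and a set E of edges, each edge being a
two-element subset of V. Points of the plane are elements of real^2.
The straight-line segment of an edge e = {u,v} under the placement p is
closed_segment (p u) (p v), i.e. the convex hull of p ` e.\<close>

definition edge_segment :: "('a \<Rightarrow> real^2) \<Rightarrow> 'a set \<Rightarrow> (real^2) set" where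
  "edge_segment p e = convex hull (p ` e)"

definition has_geometric_layering :: "'a set \<Rightarrow> 'a set set \<Rightarrow> nat \<Rightarrow> bool" where
  "has_geometric_layering V E k \<longleftrightarrow>
     (\<exists>(p :: 'a \<Rightarrow> real^2) (c :: 'a set \<Rightarrow> nat).
        inj_on p V
      \<and> (\<forall>e\<in>E. \<forall>w\<in>V. w \<notin> e \<longrightarrow> p w \<notin> edge_segment p e)
      \<and> (\<forall>e\<in>E. c e < k)
      \<and> (\<forall>e\<in>E. \<forall>f\<in>E. e \<noteq> f \<and> c e = c f \<longrightarrow>
            edge_segment p e \<inter> edge_segment p f \<subseteq> p ` (e \<inter> f)))"

definition geometric_thickness :: "'a set \<Rightarrow> 'a set set \<Rightarrow> nat" where
  "geometric_thickness V E = (LEAST k. has_geometric_layering V E k)"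

definition Kmn_vertices :: "nat \<Rightarrow> nat \<Rightarrow> (nat + nat) set" where
  "Kmn_vertices m n = Inl ` {..<m} \<union> Inr ` {..<n}"

definition Kmn_edges :: "nat \<Rightarrow> nat \<Rightarrow> (nat + nat) set set" where
  "Kmn_edges m n = {{Inl i, Inr j} | i j. i < m \<and> j < n}"

end

theory Submission
  imports Defs
begin

text \<open>
Three layers: put the eight vertices on the x-axis and let each layer consist of two stars,
centred at a point above and a point below the axis.

Two layers are not enough by a count of sides of edges. After a shear all vertices have distinct
x-coordinates. Extend a layer to a maximal plane drawing, that is, a triangulation. Every triangle is
determined by its middle vertex (in x-order) and by whether its long edge passes above or below that
vertex, so with \<open>n\<close> vertices, of which \<open>h\<close> lie on the boundary of the convex hull, there are at most
\<open>2 n - 2 - h\<close> triangles. A layer of a bipartite graph contains at most two edges of each triangle,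
and every side of an edge is the side of a triangle unless the edge lies on the hull with that side facing
outwards. As each hull edge lies in only one layer, two layers with \<open>m\<close> edges together satisfy
\<open>2 m - h \<le> 4 (2 n - 2 - h)\<close>. Since \<open>h \<ge> 3\<close>, this fails for \<open>n = 14\<close> and \<open>m = 48\<close>.
\<close>

section \<open>Extremal elements of finite sets\<close>

lemma finite_argmax:
  fixes f :: "'a \<Rightarrow> real"
  assumes "finite S" "S \<noteq> {}"
  shows "\<exists>x\<in>S. \<forall>y\<in>S. f y \<le> f x"
proof -
  have "Max (f ` S) \<in> f ` S" using assms by (intro Max_in) auto
  then obtain x where "x \<in> S" "f x = Max (f ` S)" by auto
  then show ?thesis using assms by (intro bexI[of _ x]) simp_all
qed

lemma finite_argmin:
  fixes f :: "'a \<Rightarrow> real"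
  assumes "finite S" "S \<noteq> {}"
  shows "\<exists>x\<in>S. \<forall>y\<in>S. f x \<le> f y"
  using finite_argmax[OF assms, of "\<lambda>x. - f x"] by simp

section \<open>Heights of lines over the x-axis\<close>

text \<open>The argument is not restricted to the span of \<open>p\<close> and \<open>q\<close>:
  edges are also compared along their extensions.\<close>

definition height :: "('a \<Rightarrow> real) \<Rightarrow> ('a \<Rightarrow> real) \<Rightarrow> 'a \<Rightarrow> 'a \<Rightarrow> real \<Rightarrow> real" where
  "height X Y p q x = Y p + (Y q - Y p) / (X q - X p) * (x - X p)"

lemma height_left [simp]: "height X Y p q (X p) = Y p"
  by (simp add: height_def)

lemma height_right [simp]: "X p \<noteq> X q \<Longrightarrow> height X Y p q (X q) = Y q"
  by (simp add: height_def)

lemma height_sym: "X p \<noteq> X q \<Longrightarrow> height X Y q p x = height X Y p q x"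
  by (simp add: height_def divide_simps) argo

lemma height_mirror [simp]: "height (\<lambda>v. - X v) Y p q x = height X Y p q (- x)"
  by (simp add: height_def divide_simps) argo

lemma height_reflect [simp]: "height X (\<lambda>v. - Y v) p q x = - height X Y p q x"
  by (simp add: height_def divide_simps) argo

text \<open>A difference of two lines is affine, and \<open>k\<close> is the difference of the
  slopes. The base point \<open>x\<close> is free; placing it where the lines meet removes the
  constant term, so that comparisons reduce to the sign of \<open>k * (y - x)\<close>.\<close>

lemma height_diff_affine:
  "\<exists>k. \<forall>y. height X Y p q y - height X Y r s y = height X Y p q x - height X Y r s x + k * (y - x)"
proof -
  have "\<exists>k. \<forall>y. (a + b * (y - c)) - (a' + b' * (y - c'))
      = (a + b * (x - c)) - (a' + b' * (x - c')) + k * (y - x)" for a b c a' b' c' :: real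
    by (intro exI[of _ "b - b'"]) (simp add: algebra_simps)
  then show ?thesis unfolding height_def .
qed

text \<open>An affine function that is nonpositive at \<open>x1\<close> and positive at
  \<open>x2\<close> stays positive when moving on beyond \<open>x2\<close>.\<close>

lemma height_less_extrapolate:
  assumes "height X Y r s x1 \<le> height X Y p q x1" "height X Y p q x2 < height X Y r s x2"
    and "x1 < x2 \<and> x2 \<le> x3 \<or> x3 \<le> x2 \<and> x2 < x1"
  shows "height X Y p q x3 < height X Y r s x3"
proof -
  obtain k where k: "\<And>y. height X Y r s y - height X Y p q y
    = height X Y r s x2 - height X Y p q x2 + k * (y - x2)"
    using height_diff_affine[of X Y r s p q x2] by auto
  have "k * (x1 - x2) < 0" using k[of x1] assms(1,2) by linarith
  then have "k * (x3 - x2) \<ge> 0"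
    using assms(3) by (auto simp: mult_less_0_iff zero_le_mult_iff)
  then show ?thesis using k[of x3] assms(2) by linarith
qed

lemma height_less_ray:
  assumes eq: "height X Y p q z = height X Y r s z" and less: "height X Y p q x < height X Y r s x"
    and side: "x < z \<and> y < z \<or> z < x \<and> z < y"
  shows "height X Y p q y < height X Y r s y"
proof -
  obtain k where k: "\<And>y. height X Y r s y - height X Y p q y = k * (y - z)"
    using height_diff_affine[of X Y r s p q z] eq by auto
  have "k * (x - z) > 0" using k[of x] less by linarith
  then have "k * (y - z) > 0" using side by (auto simp: zero_less_mult_iff)
  then show ?thesis using k[of y] by linarith
qed

text \<open>The intermediate value theorem for an affine function, whose zero is
  \<open>x1 + d / k\<close>.\<close>

lemma height_crossing:
  assumes "height X Y p q x1 < height X Y r s x1" "height X Y r s x2 < height X Y p q x2"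
  obtains x where "height X Y p q x = height X Y r s x" "x1 < x \<and> x < x2 \<or> x2 < x \<and> x < x1"
proof -
  obtain k where k: "\<And>y. height X Y p q y - height X Y r s y
    = height X Y p q x1 - height X Y r s x1 + k * (y - x1)"
    using height_diff_affine[of X Y p q r s x1] by auto
  define d where "d = height X Y r s x1 - height X Y p q x1"
  have d: "d > 0" and kd: "k * (x2 - x1) > d"
    using k[of x2] assms by (auto simp: d_def)
  have "k \<noteq> 0" using d kd by auto
  show ?thesis
  proof
    have "k * ((x1 + d / k) - x1) = d" using \<open>k \<noteq> 0\<close> by simp
    then show "height X Y p q (x1 + d / k) = height X Y r s (x1 + d / k)"
      using k[of "x1 + d / k"] by (simp add: d_def)
    show "x1 < x1 + d / k \<and> x1 + d / k < x2 \<or> x2 < x1 + d / k \<and> x1 + d / k < x1"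
    proof (cases "k > 0")
      case True
      then show ?thesis using d kd by (simp add: field_simps)
    next
      case False
      then have "k < 0" using \<open>k \<noteq> 0\<close> by simp
      then show ?thesis using d kd by (simp add: field_simps)
    qed
  qed
qed

text \<open>An affine function that is positive inside an interval is positive at one of the two
  ends. The shift \<open>c\<close> serves later as the largest excess of a vertex over a
  line.\<close>

lemma height_less_endpoint:
  assumes "X r < x" "x < X s" "height X Y p q x + c < height X Y r s x"
  shows "height X Y p q (X r) + c < Y r \<or> height X Y p q (X s) + c < Y s"
proof (rule ccontr)
  assume *: "\<not> ?thesis"
  obtain k where k: "\<And>y. height X Y r s y - height X Y p q y
    = height X Y r s x - height X Y p q x + k * (y - x)"
    using height_diff_affine[of X Y r s p q x] by auto
  have "k * (X r - x) < 0" "k * (X s - x) < 0"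
    using k[of "X r"] k[of "X s"] * assms by auto
  then show False using assms by (auto simp: mult_less_0_iff)
qed

section \<open>Straight-line drawings\<close>

text \<open>Edges are stored in both orientations, so that the mirror image \<open>X \<mapsto> - X\<close> of a drawing has the
same edge set; statements about an edge \<open>(p, q)\<close> usually pick the orientation with \<open>X p < X q\<close>.\<close>

locale line_drawing =
  fixes V :: "'a set" and X Y :: "'a \<Rightarrow> real" and T :: "('a \<times> 'a) set"
  assumes finite_V: "finite V" and inj_X: "inj_on X V"
    and T_V: "T \<subseteq> V \<times> V" and irrefl_T: "(p, p) \<notin> T"
    and sym_T: "(p, q) \<in> T \<Longrightarrow> (q, p) \<in> T"
    and avoid: "\<lbrakk>(p, q) \<in> T; w \<in> V; X p < X w; X w < X q\<rbrakk> \<Longrightarrow> height X Y p q (X w) \<noteq> Y w"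
    and noncrossing: "\<lbrakk>(p, q) \<in> T; (r, s) \<in> T; X p < X q; X r < X s; X p \<le> x; x \<le> X q;
        X r \<le> x; x \<le> X s; height X Y p q x = height X Y r s x\<rbrakk>
      \<Longrightarrow> p = r \<and> q = s \<or> (\<exists>c\<in>{p, q} \<inter> {r, s}. x = X c)"
begin

lemma edgeD: "(p, q) \<in> T \<Longrightarrow> p \<in> V \<and> q \<in> V \<and> X p \<noteq> X q"
  using T_V irrefl_T inj_X by (auto dest: inj_onD)

lemma X_eqD: "X p = X q \<Longrightarrow> p \<in> V \<Longrightarrow> q \<in> V \<Longrightarrow> p = q"
  using inj_X by (auto dest: inj_onD)

lemma finite_T: "finite T"
  using finite_subset[OF T_V] finite_V by blast

text \<open>A reversal of the order would give a common point strictly between \<open>x1\<close> and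
  \<open>x2\<close>, hence inside both edges. Equality at \<open>x2\<close> itself is possible only
  at a shared endpoint, which the strict version excludes.\<close>

lemma height_order:
  assumes pq: "(p, q) \<in> T" "X p \<le> x1" "x1 \<le> X q" "X p \<le> x2" "x2 \<le> X q"
    and rs: "(r, s) \<in> T" "X r \<le> x1" "x1 \<le> X s" "X r \<le> x2" "x2 \<le> X s"
    and less: "height X Y p q x1 < height X Y r s x1"
  shows height_order_le: "height X Y p q x2 \<le> height X Y r s x2"
    and height_order_less: "X p < x2 \<and> x2 < X q \<or> X r < x2 \<and> x2 < X s \<Longrightarrow>
      height X Y p q x2 < height X Y r s x2"
proof -
  have ord: "X p < X q" "X r < X s" using edgeD pq rs by force+
  have same: "\<not> (p = r \<and> q = s)" using less by auto
  show le: "height X Y p q x2 \<le> height X Y r s x2"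
  proof (rule ccontr)
    assume "\<not> ?thesis"
    then obtain x where x: "height X Y p q x = height X Y r s x"
      "x1 < x \<and> x < x2 \<or> x2 < x \<and> x < x1"
      using height_crossing[OF less, of x2] by force
    then show False
      using noncrossing[OF pq(1) rs(1) ord, of x] same pq rs by auto
  qed
  assume "X p < x2 \<and> x2 < X q \<or> X r < x2 \<and> x2 < X s"
  then have "height X Y p q x2 \<noteq> height X Y r s x2"
    using noncrossing[OF pq(1) rs(1) ord, of x2] same pq rs by auto
  then show "height X Y p q x2 < height X Y r s x2" using le by simp
qed

text \<open>Mirroring changes which orientation of an edge runs from left to right, and the symmetry
  of \<open>T\<close> absorbs this. Results about left ends thereby transfer to right ends.\<close>

lemma mirror: "line_drawing V (\<lambda>v. - X v) Y T"
proof
  fix p q w assume "(p, q) \<in> T" "w \<in> V" "- X p < - X w" "- X w < - X q"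
  then show "height (\<lambda>v. - X v) Y p q (- X w) \<noteq> Y w"
    using avoid[of q p w] sym_T[of p q] height_sym[of X q p] by auto
next
  fix p q r s x
  assume "(p, q) \<in> T" "(r, s) \<in> T" "- X p < - X q" "- X r < - X s" "- X p \<le> x" "x \<le> - X q"
    "- X r \<le> x" "x \<le> - X s" "height (\<lambda>v. - X v) Y p q x = height (\<lambda>v. - X v) Y r s x"
  then have "q = s \<and> p = r \<or> (\<exists>c\<in>{q, p} \<inter> {s, r}. - x = X c)"
    by (intro noncrossing) (auto simp: sym_T height_sym)
  moreover have "- x = X c \<longleftrightarrow> x = - X c" for c by linarith
  ultimately show "p = r \<and> q = s \<or> (\<exists>c\<in>{p, q} \<inter> {r, s}. x = - X c)"
    by (simp add: insert_commute conj_commute)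
qed (use finite_V inj_X T_V irrefl_T sym_T in \<open>auto simp: inj_on_def\<close>)

lemma reflect: "line_drawing V X (\<lambda>v. - Y v) T"
proof
  fix p q r s x
  assume "(p, q) \<in> T" "(r, s) \<in> T" "X p < X q" "X r < X s" "X p \<le> x" "x \<le> X q" "X r \<le> x" "x \<le> X s"
    "height X (\<lambda>v. - Y v) p q x = height X (\<lambda>v. - Y v) r s x"
  then show "p = r \<and> q = s \<or> (\<exists>c\<in>{p, q} \<inter> {r, s}. x = X c)"
    using noncrossing[of p q r s x] by simp
qed (use finite_V inj_X T_V irrefl_T sym_T avoid in \<open>auto simp: inj_on_def\<close>)

end

text \<open>In a maximal drawing this says that \<open>p\<close>, \<open>v\<close>, \<open>q\<close> are the corners of a triangular face with
middle vertex \<open>v\<close>. The faces whose long edge is below \<open>v\<close> are obtained by negating \<open>Y\<close>.\<close>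

definition lowest_above ::
    "('a \<Rightarrow> real) \<Rightarrow> ('a \<Rightarrow> real) \<Rightarrow> ('a \<times> 'a) set \<Rightarrow> 'a \<Rightarrow> 'a \<Rightarrow> 'a \<Rightarrow> bool" where
  "lowest_above X Y T p q v \<longleftrightarrow> (p, q) \<in> T \<and> X p < X v \<and> X v < X q \<and> Y v < height X Y p q (X v) \<and>
     (\<forall>r s. (r, s) \<in> T \<longrightarrow> X r < X v \<longrightarrow> X v < X s \<longrightarrow> Y v < height X Y r s (X v) \<longrightarrow>
        height X Y p q (X v) \<le> height X Y r s (X v))"

lemma (in line_drawing) lowest_above_mirror:
  "lowest_above (\<lambda>v. - X v) Y T q p v \<longleftrightarrow> lowest_above X Y T p q v"
proof -
  have *: "(r, s) \<in> T \<longleftrightarrow> (s, r) \<in> T" for r s using sym_T by blast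
  have **: "height X Y r s x = height X Y s r x" if "(r, s) \<in> T" for r s x
    using height_sym[of X s r] edgeD[OF that] by metis
  show ?thesis
    unfolding lowest_above_def using * ** by (auto simp: height_sym) metis+
qed

text \<open>Inclusion-maximality in working form: it is tested on one pair at a time, so an edge is
  obtained by checking its segment against the vertices and edges present.\<close>

locale maximal_line_drawing = line_drawing +
  assumes maximal: "\<lbrakk>p \<in> V; q \<in> V; X p < X q;
      \<And>w. \<lbrakk>w \<in> V; X p < X w; X w < X q\<rbrakk> \<Longrightarrow> height X Y p q (X w) \<noteq> Y w;
      \<And>r s x. \<lbrakk>(r, s) \<in> T; X r < X s; X p \<le> x; x \<le> X q; X r \<le> x; x \<le> X s;
          height X Y p q x = height X Y r s x\<rbrakk>
        \<Longrightarrow> p = r \<and> q = s \<or> (\<exists>c\<in>{p, q} \<inter> {r, s}. x = X c)\<rbrakk>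
    \<Longrightarrow> (p, q) \<in> T"
begin

lemma maximal_mirror: "maximal_line_drawing V (\<lambda>v. - X v) Y T"
proof -
  interpret m: line_drawing V "\<lambda>v. - X v" Y T by (rule mirror)
  show ?thesis
  proof
    fix p q
    assume A: "p \<in> V" "q \<in> V" "- X p < - X q"
      "\<And>w. \<lbrakk>w \<in> V; - X p < - X w; - X w < - X q\<rbrakk> \<Longrightarrow> height (\<lambda>v. - X v) Y p q (- X w) \<noteq> Y w"
      "\<And>r s x. \<lbrakk>(r, s) \<in> T; - X r < - X s; - X p \<le> x; x \<le> - X q; - X r \<le> x; x \<le> - X s;
          height (\<lambda>v. - X v) Y p q x = height (\<lambda>v. - X v) Y r s x\<rbrakk>
        \<Longrightarrow> p = r \<and> q = s \<or> (\<exists>c\<in>{p, q} \<inter> {r, s}. x = - X c)"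
    have "(q, p) \<in> T"
    proof (rule maximal)
      fix r s x
      assume "(r, s) \<in> T" "X r < X s" "X q \<le> x" "x \<le> X p" "X r \<le> x" "x \<le> X s"
          "height X Y q p x = height X Y r s x"
      then have "p = s \<and> q = r \<or> (\<exists>c\<in>{p, q} \<inter> {s, r}. - x = - X c)"
        using A(3) by (intro A(5)) (auto simp: sym_T height_sym)
      then show "q = r \<and> p = s \<or> (\<exists>c\<in>{q, p} \<inter> {r, s}. x = X c)"
        by (simp add: insert_commute conj_commute)
    qed (use A height_sym[of X q p] in auto)
    then show "(p, q) \<in> T" by (rule sym_T)
  qed
qed

lemma maximal_reflect: "maximal_line_drawing V X (\<lambda>v. - Y v) T"
proof -
  interpret m: line_drawing V X "\<lambda>v. - Y v" T by (rule reflect)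
  show ?thesis
    by unfold_locales (rule maximal; auto)
qed

text \<open>Among the vertices that see \<open>pq\<close> from below, the one closest to it is joined to \<open>p\<close>: the
vertex \<open>u\<close> between \<open>pw\<close> and \<open>pq\<close> that is steepest from \<open>p\<close> would be closer to \<open>pq\<close>, hence hidden by an edge,
and that edge can end nowhere before it hides \<open>w\<close> as well.\<close>

lemma left_spoke:
  assumes w: "lowest_above X Y T p q w" "w \<in> V"
    and closest: "\<And>v. v \<in> V \<Longrightarrow> lowest_above X Y T p q v \<Longrightarrow>
      height X Y p q (X w) - Y w \<le> height X Y p q (X v) - Y v"
  shows no_vertex_left: "\<And>u. \<lbrakk>u \<in> V; X p < X u; X u < X w; Y u < height X Y p q (X u)\<rbrakk>
      \<Longrightarrow> Y u < height X Y p w (X u)"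
    and left_spoke_edge: "(p, w) \<in> T"
    and left_unique: "\<And>v. \<lbrakk>v \<in> V; lowest_above X Y T p q v\<rbrakk> \<Longrightarrow> X w \<le> X v"
proof -
  have pq: "(p, q) \<in> T" and pw: "X p < X w" and wq: "X w < X q" and Yw: "Y w < height X Y p q (X w)"
    and lowest: "\<And>r s. \<lbrakk>(r, s) \<in> T; X r < X w; X w < X s; Y w < height X Y r s (X w)\<rbrakk> \<Longrightarrow>
        height X Y p q (X w) \<le> height X Y r s (X w)"
    using w by (auto simp: lowest_above_def)
  have pV: "p \<in> V" and qV: "q \<in> V" using edgeD[OF pq] by auto
  \<comment> \<open>The two lines meet at \<open>p\<close>, and \<open>k\<close> is the slope of
    \<open>pq\<close> minus that of \<open>pw\<close>; it is positive because \<open>w\<close> lies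
    below \<open>pq\<close>.\<close>
  obtain k where k: "\<And>y. height X Y p q y - height X Y p w y = k * (y - X p)"
    using height_diff_affine[of X Y p q p w "X p"] by auto
  have "k > 0" using k[of "X w"] pw Yw zero_less_mult_pos2[of k "X w - X p"] by simp
  have below: "height X Y p w x < height X Y p q x" if "X p < x" for x
    using k[of x] mult_pos_pos[of k "x - X p"] \<open>k > 0\<close> that by linarith
  \<comment> \<open>These are the vertices that obstruct the spoke \<open>pw\<close>: strictly
    between \<open>p\<close> and \<open>w\<close> in x-order, on or above \<open>pw\<close>, and
    below \<open>pq\<close>.\<close>
  define S where "S = {u \<in> V. X p < X u \<and> X u < X w \<and> height X Y p w (X u) \<le> Y u
    \<and> Y u < height X Y p q (X u)}"
  define sl where "sl u = (Y u - Y p) / (X u - X p)" for u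
  have height_sl: "height X Y p u y = Y p + sl u * (y - X p)" for u y
    by (simp add: height_def sl_def)
  have "S = {}"
  proof (rule ccontr)
    assume "S \<noteq> {}"
    moreover have "finite S" using finite_V by (simp add: S_def)
    ultimately obtain u where u: "u \<in> S" and steepest: "\<And>v. v \<in> S \<Longrightarrow> sl v \<le> sl u"
      using finite_argmax[of S sl] by blast
    have uV: "u \<in> V" and pu: "X p < X u" and uw: "X u < X w"
      and Yu: "height X Y p w (X u) \<le> Y u" "Y u < height X Y p q (X u)"
      using u by (auto simp: S_def)
    have "sl w \<le> sl u"
    proof -
      have "sl w * (X u - X p) \<le> sl u * (X u - X p)"
        using Yu(1) pu height_sl[of w "X u"] height_sl[of u "X u"] height_right[of X p u Y] by simp
      then show ?thesis using pu by simp
    qed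
    then have ray: "height X Y p w y \<le> height X Y p u y" if "X p \<le> y" for y
      using that by (simp add: height_sl mult_right_mono)
    have not_steeper: False
      if "v \<in> V" "X p < X v" "X v < X w" "height X Y p u (X v) < Y v" "Y v < height X Y p q (X v)" for v
    proof -
      have "v \<in> S" using that ray[of "X v"] by (auto simp: S_def)
      moreover have "sl u * (X v - X p) < sl v * (X v - X p)"
        using that height_sl[of u "X v"] height_sl[of v "X v"] height_right[of X p v Y] by simp
      then have "sl u < sl v" using that by simp
      ultimately show False using steepest by force
    qed
    \<comment> \<open>The gap below \<open>pq\<close> is at most \<open>k * (X u - X p)\<close> at
      \<open>u\<close>, less than the gap at \<open>w\<close>, so \<open>u\<close> would be closer
      than \<open>w\<close>.\<close>
    have "\<not> lowest_above X Y T p q u"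
    proof
      assume "lowest_above X Y T p q u"
      then have "height X Y p q (X w) - Y w \<le> height X Y p q (X u) - Y u"
        using closest uV by blast
      also have "\<dots> \<le> k * (X u - X p)" using Yu k[of "X u"] by simp
      also have "\<dots> < k * (X w - X p)" using \<open>k > 0\<close> uw by simp
      also have "\<dots> = height X Y p q (X w) - Y w" using k[of "X w"] pw by simp
      finally show False by simp
    qed
    then obtain r s where rs: "(r, s) \<in> T" and ru: "X r < X u" and us: "X u < X s"
      and above: "Y u < height X Y r s (X u)" and under: "height X Y r s (X u) < height X Y p q (X u)"
      using pq pu uw wq Yu unfolding lowest_above_def by force
    have rV: "r \<in> V" and sV: "s \<in> V" using edgeD[OF rs] by auto
    have keep_le: "height X Y r s x \<le> height X Y p q x"
      and keep: "X p < x \<and> x < X q \<Longrightarrow> height X Y r s x < height X Y p q x"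
      if "X p \<le> x" "x \<le> X q" "X r \<le> x" "x \<le> X s" for x
      using height_order[OF rs _ _ _ _ pq, of "X u" x] that pu uw wq ru us under by auto
    have ray_u: "height X Y p u (X u) = Y u" using pu by simp
    \<comment> \<open>Left of \<open>u\<close> the edge \<open>rs\<close> is somewhere on or below
      the ray from \<open>p\<close> through \<open>u\<close>: at \<open>r\<close>, since no vertex
      is steeper than \<open>u\<close>, or at \<open>p\<close>, since \<open>rs\<close> stays below
      \<open>pq\<close>.\<close>
    obtain x1 where x1: "x1 < X u" "height X Y r s x1 \<le> height X Y p u x1"
    proof (cases "X p < X r")
      case True
      then have "height X Y r s (X r) < height X Y p q (X r)"
        using keep[of "X r"] ru us uw wq by simp
      then have "\<not> height X Y p u (X r) < Y r"
        using not_steeper[OF rV True] ru uw by force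
      then show ?thesis using that[of "X r"] ru by simp
    next
      case False
      then have "height X Y r s (X p) \<le> height X Y p q (X p)"
        using keep_le[of "X p"] pu us pw wq by simp
      then show ?thesis using that[of "X p"] pu by simp
    qed
    have right: "height X Y p u x < height X Y r s x" if "X u \<le> x" for x
      using height_less_extrapolate[OF x1(2), of "X u" x] x1(1) above ray_u that by simp
    \<comment> \<open>From \<open>u\<close> on, \<open>rs\<close> runs above the ray. Either it ends
      before \<open>w\<close>, at a vertex steeper than \<open>u\<close>, or it separates
      \<open>w\<close> from \<open>pq\<close>.\<close>
    show False
    proof (cases "X s < X w")
      case True
      then have "height X Y r s (X s) < height X Y p q (X s)"
        using keep[of "X s"] ru us uw wq pu by simp
      then show False
        using not_steeper[OF sV _ True] right[of "X s"] pu us ru by simp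
    next
      case False
      have "height X Y r s (X w) < height X Y p q (X w)"
        using keep[of "X w"] False ru us uw wq pu by simp
      moreover have over: "Y w < height X Y r s (X w)"
        using right[of "X w"] uw ray[of "X w"] pw by simp
      moreover have "X w \<noteq> X s"
        using over X_eqD[OF _ w(2) sV] ru us by auto
      ultimately show False using lowest[OF rs] False ru uw by force
    qed
  qed
  then show no_left: "Y u < height X Y p w (X u)"
    if "u \<in> V" "X p < X u" "X u < X w" "Y u < height X Y p q (X u)" for u
    using that by (force simp: S_def)
  show "(p, w) \<in> T"
  proof (rule maximal[OF pV w(2) pw])
    fix v assume "v \<in> V" "X p < X v" "X v < X w"
    then show "height X Y p w (X v) \<noteq> Y v"
      using no_left[of v] below[of "X v"] by force
  next
    fix r s x
    assume rs: "(r, s) \<in> T" and ord: "X r < X s" and x: "X p \<le> x" "x \<le> X w" "X r \<le> x" "x \<le> X s"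
      and eq: "height X Y p w x = height X Y r s x"
    have rV: "r \<in> V" and sV: "s \<in> V" using edgeD[OF rs] by auto
    consider "x = X p" | "x = X w" | "X p < x" "x < X w" using x by fastforce
    then show "p = r \<and> w = s \<or> (\<exists>c\<in>{p, w} \<inter> {r, s}. x = X c)"
    proof cases
      case 1
      then have "X r = X p \<or> X s = X p" using avoid[OF rs pV] eq x by force
      then show ?thesis using 1 X_eqD[OF _ rV pV] X_eqD[OF _ sV pV] by auto
    next
      case 2
      then have "X r = X w \<or> X s = X w" using avoid[OF rs w(2)] eq x pw by force
      then show ?thesis using 2 X_eqD[OF _ rV w(2)] X_eqD[OF _ sV w(2)] by auto
    next
      case 3
      have keep_le: "height X Y r s y \<le> height X Y p q y"
        and keep: "X p < y \<and> y < X q \<Longrightarrow> height X Y r s y < height X Y p q y"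
        if "X p \<le> y" "y \<le> X q" "X r \<le> y" "y \<le> X s" for y
        using height_order[OF rs _ _ _ _ pq, of x y] that x wq below[OF 3(1)] eq by auto
      obtain c where c: "\<And>y. height X Y r s y - height X Y p w y = c * (y - x)"
        using height_diff_affine[of X Y r s p w x] eq by auto
      \<comment> \<open>On the side where \<open>rs\<close> is on or above \<open>pw\<close>, an
        endpoint strictly between \<open>p\<close> and \<open>w\<close> would violate
        \<open>no_left\<close>.\<close>
      have no_end: False
        if "X p < X z" "X z < X w" "z = r \<or> z = s" "c * (X z - x) \<ge> 0" for z
      proof -
        have "z \<in> V" "height X Y r s (X z) = Y z" using that rV sV ord by auto
        moreover have "Y z < height X Y p q (X z)"
          using keep[of "X z"] that wq ord calculation by auto
        ultimately show False using no_left[of z] that c[of "X z"] by auto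
      qed
      have s_right: "X s \<ge> X w" if "c \<ge> 0"
        using no_end[of s] that x 3 by force
      have r_left: "X r \<le> X p" if "c \<le> 0"
        using no_end[of r] that x 3 by (force simp: mult_nonpos_nonpos)
      \<comment> \<open>If \<open>rs\<close> rises relative to \<open>pw\<close>, it separates
        \<open>w\<close> from \<open>pq\<close>; if it falls, it passes above \<open>p\<close> and
        so above \<open>pq\<close> there. If the lines coincide, \<open>avoid\<close> forces the
        endpoints to coincide.\<close>
      consider "c > 0" | "c < 0" | "c = 0" by linarith
      then show ?thesis
      proof cases
        case 1
        then have over: "Y w < height X Y r s (X w)"
          using c[of "X w"] 3 pw by (smt (verit) height_right mult_pos_pos)
        have "height X Y r s (X w) < height X Y p q (X w)"
          using keep[of "X w"] s_right 1 pw wq x 3 by force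
        moreover have "X w \<noteq> X s"
          using over X_eqD[OF _ w(2) sV] ord by auto
        ultimately show ?thesis using lowest[OF rs] s_right 1 x 3 over by force
      next
        case 2
        then have "Y p < height X Y r s (X p)"
          using c[of "X p"] 3 pw by (smt (verit) height_left mult_neg_neg)
        then show ?thesis using keep_le[of "X p"] r_left 2 pw wq x 3 by force
      next
        case 3
        have "height X Y r s (X w) = Y w" "height X Y r s (X p) = Y p"
          using c[of "X w"] c[of "X p"] 3 pw by auto
        then have "X r = X p" "X s = X w"
          using avoid[OF rs w(2)] avoid[OF rs pV] s_right r_left 3 pw by force+
        then show ?thesis using X_eqD[OF _ rV pV] X_eqD[OF _ sV w(2)] by auto
      qed
    qed
  qed
  \<comment> \<open>A candidate \<open>v\<close> further left would lie below the edge
    \<open>pw\<close>, which is lower than \<open>pq\<close> over \<open>v\<close>.\<close>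
  then show "X w \<le> X v" if v: "v \<in> V" "lowest_above X Y T p q v" for v
    using no_left[of v] below[of "X v"] v pw unfolding lowest_above_def by force
qed

text \<open>The candidate closest to \<open>pq\<close> is leftmost by \<open>left_unique\<close> and
  rightmost by its mirror image, so all candidates share one x-coordinate.\<close>

lemma lowest_above_unique:
  assumes v: "v \<in> V" "lowest_above X Y T p q v" and v': "v' \<in> V" "lowest_above X Y T p q v'"
  shows "v = v'"
proof -
  interpret m: maximal_line_drawing V "\<lambda>v. - X v" Y T by (rule maximal_mirror)
  define f where "f v = height X Y p q (X v) - Y v" for v
  define W where "W = {v \<in> V. lowest_above X Y T p q v}"
  have "finite W" "W \<noteq> {}" using finite_V v by (auto simp: W_def)
  then obtain w where w: "w \<in> W" and least: "\<And>v. v \<in> W \<Longrightarrow> f w \<le> f v"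
    using finite_argmin[of W f] by blast
  have pq: "X p \<noteq> X q" using v by (auto simp: lowest_above_def)
  have "X w \<le> X u \<and> X u \<le> X w" if "u \<in> W" for u
  proof
    show "X w \<le> X u"
      using left_unique[of p q w u] w least that by (auto simp: W_def f_def)
    have "- X w \<le> - X u"
      by (rule m.left_unique[of q p w u])
        (use w least that pq in \<open>auto simp: W_def f_def lowest_above_mirror height_sym\<close>)
    then show "X u \<le> X w" by simp
  qed
  from this[of v] this[of v'] have "X v = X v'" using v v' by (auto simp: W_def)
  then show ?thesis using X_eqD v v' by blast
qed

text \<open>Both edges attain the same minimal height over \<open>v\<close>. Distinct edges could
  touch there only at a common endpoint, but both pass strictly over \<open>v\<close>.\<close>

lemma lowest_above_fun:
  assumes "lowest_above X Y T p q v" "lowest_above X Y T r s v" "v \<in> V"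
  shows "p = r \<and> q = s"
proof -
  have "height X Y p q (X v) = height X Y r s (X v)"
    using assms unfolding lowest_above_def by (meson order_antisym)
  then show ?thesis
    using noncrossing[of p q r s "X v"] assms by (auto simp: lowest_above_def)
qed

text \<open>The edge immediately below \<open>ab\<close> can only change at a vertex that sees \<open>ab\<close>.\<close>

lemma right_vertex:
  assumes ab: "(a, b) \<in> T" "X a < x" "x < X b" and pq: "(p, q) \<in> T" "X p < x" "x < X q"
    and first: "\<And>r s. \<lbrakk>(r, s) \<in> T; X r < x; x < X s; height X Y r s x < height X Y a b x\<rbrakk> \<Longrightarrow>
      height X Y r s x \<le> height X Y p q x"
    and u: "u \<in> V" "x \<le> X u" "X u < X b" "X u \<le> X q" "height X Y p q (X u) \<le> Y u"
      "Y u < height X Y a b (X u)"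
  shows "\<exists>v\<in>V. lowest_above X Y T a b v"
proof -
  define S where "S = {u \<in> V. x \<le> X u \<and> X u < X b \<and> X u \<le> X q \<and> height X Y p q (X u) \<le> Y u
    \<and> Y u < height X Y a b (X u)}"
  have "finite S" "S \<noteq> {}" using finite_V u by (auto simp: S_def)
  then obtain v where v: "v \<in> S" and least: "\<And>u. u \<in> S \<Longrightarrow> X v \<le> X u"
    using finite_argmin[of S X] by blast
  have vV: "v \<in> V" and xv: "x \<le> X v" "X v < X b" "X v \<le> X q"
    and Yv: "height X Y p q (X v) \<le> Y v" "Y v < height X Y a b (X v)"
    using v by (auto simp: S_def)
  \<comment> \<open>Suppose \<open>rs\<close> separates \<open>v\<close> from \<open>ab\<close>. If
    \<open>r\<close> is not left of \<open>x\<close>, it belongs to \<open>S\<close> and precedes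
    the leftmost element \<open>v\<close>; otherwise \<open>rs\<close> already runs between
    \<open>pq\<close> and \<open>ab\<close> over \<open>x\<close>, against
    \<open>first\<close>.\<close>
  have "lowest_above X Y T a b v"
    unfolding lowest_above_def
  proof (intro conjI allI impI)
    fix r s
    assume rs: "(r, s) \<in> T" "X r < X v" "X v < X s" "Y v < height X Y r s (X v)"
    show "height X Y a b (X v) \<le> height X Y r s (X v)"
    proof (rule ccontr)
      assume "\<not> ?thesis"
      then have rs_ab: "height X Y r s (X v) < height X Y a b (X v)" by simp
      have pq_rs: "height X Y p q (X v) < height X Y r s (X v)" using Yv rs by simp
      have rV: "r \<in> V" using edgeD[OF rs(1)] by simp
      show False
      proof (cases "x \<le> X r")
        case True
        have "height X Y p q (X r) < height X Y r s (X r)"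
          by (rule height_order_less[OF pq(1) _ _ _ _ rs(1), of "X v"])
            (use True pq_rs pq rs xv in auto)
        moreover have "height X Y r s (X r) < height X Y a b (X r)"
          by (rule height_order_less[OF rs(1) _ _ _ _ ab(1), of "X v"])
            (use True rs_ab ab rs xv in auto)
        ultimately have "r \<in> S" using rV True rs xv by (simp add: S_def)
        then show False using least rs by force
      next
        case False
        have "height X Y p q x < height X Y r s x"
          by (rule height_order_less[OF pq(1) _ _ _ _ rs(1), of "X v"])
            (use False pq_rs pq rs xv in auto)
        moreover have "height X Y r s x < height X Y a b x"
          by (rule height_order_less[OF rs(1) _ _ _ _ ab(1), of "X v"])
            (use False rs_ab ab rs xv in auto)
        ultimately show False using first[OF rs(1)] False rs xv by force
      qed
    qed
  qed (use ab xv Yv in auto)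
  then show ?thesis using vV by blast
qed

lemma left_vertex:
  assumes ab: "(a, b) \<in> T" "X a < x" "x < X b" and pq: "(p, q) \<in> T" "X p < x" "x < X q"
    and first: "\<And>r s. \<lbrakk>(r, s) \<in> T; X r < x; x < X s; height X Y r s x < height X Y a b x\<rbrakk> \<Longrightarrow>
      height X Y r s x \<le> height X Y p q x"
    and u: "u \<in> V" "X u \<le> x" "X a < X u" "X p \<le> X u" "height X Y p q (X u) \<le> Y u"
      "Y u < height X Y a b (X u)"
  shows "\<exists>v\<in>V. lowest_above X Y T a b v"
proof -
  interpret m: maximal_line_drawing V "\<lambda>v. - X v" Y T by (rule maximal_mirror)
  have "\<exists>v\<in>V. lowest_above (\<lambda>v. - X v) Y T b a v"
  proof (rule m.right_vertex[of b a "- x" q p u])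
    fix r s assume "(r, s) \<in> T" "- X r < - x" "- x < - X s"
      "height (\<lambda>v. - X v) Y r s (- x) < height (\<lambda>v. - X v) Y b a (- x)"
    then show "height (\<lambda>v. - X v) Y r s (- x) \<le> height (\<lambda>v. - X v) Y q p (- x)"
      using first[of s r] ab pq by (simp add: sym_T height_sym)
  qed (use ab pq u sym_T in \<open>auto simp: height_sym\<close>)
  then show ?thesis by (simp add: lowest_above_mirror)
qed

lemma lowest_above_reflect:
  "lowest_above X (\<lambda>v. - Y v) T p q v \<longleftrightarrow> (p, q) \<in> T \<and> X p < X v \<and> X v < X q \<and>
     height X Y p q (X v) < Y v \<and>
     (\<forall>r s. (r, s) \<in> T \<longrightarrow> X r < X v \<longrightarrow> X v < X s \<longrightarrow> height X Y r s (X v) < Y v \<longrightarrow>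
        height X Y r s (X v) \<le> height X Y p q (X v))"
  by (simp add: lowest_above_def)

text \<open>Here \<open>pq\<close> is the edge immediately below \<open>ab\<close> over
  \<open>x\<close>. If \<open>p\<close> were right of \<open>a\<close>, it would yield a vertex that
  sees \<open>ab\<close>. If \<open>p\<close> is left of \<open>a\<close>, an edge between
  \<open>pq\<close> and \<open>a\<close> would continue to the right, and would either end at such a
  vertex or run between \<open>pq\<close> and \<open>ab\<close> over \<open>x\<close>.\<close>

lemma overhang_left:
  assumes ab: "(a, b) \<in> T" "X a < x" "x < X b" and pq: "(p, q) \<in> T" "X p < x" "x < X q"
    and less: "height X Y p q x < height X Y a b x"
    and first: "\<And>r s. \<lbrakk>(r, s) \<in> T; X r < x; x < X s; height X Y r s x < height X Y a b x\<rbrakk> \<Longrightarrow>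
      height X Y r s x \<le> height X Y p q x"
    and none: "\<not> (\<exists>v\<in>V. lowest_above X Y T a b v)"
  shows "X p \<le> X a" and "X p < X a \<Longrightarrow> lowest_above X (\<lambda>v. - Y v) T p q a"
proof -
  note L = left_vertex[OF ab pq first]
  have V: "a \<in> V" "p \<in> V" using edgeD ab pq by blast+
  show "X p \<le> X a"
  proof (rule ccontr)
    assume *: "\<not> X p \<le> X a"
    have "height X Y p q (X p) < height X Y a b (X p)"
      by (rule height_order_less[OF pq(1) _ _ _ _ ab(1), of x]) (use * less pq ab in auto)
    then show False using L[of p] none V * pq by force
  qed
  assume pa: "X p < X a"
  have pq_a: "height X Y p q (X a) < height X Y a b (X a)"
    by (rule height_order_less[OF pq(1) _ _ _ _ ab(1), of x]) (use pa less pq ab in auto)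
  show "lowest_above X (\<lambda>v. - Y v) T p q a"
    unfolding lowest_above_reflect
  proof (intro conjI allI impI)
    fix r s assume rs: "(r, s) \<in> T" "X r < X a" "X a < X s" "height X Y r s (X a) < Y a"
    have sV: "s \<in> V" using edgeD[OF rs(1)] by simp
    show "height X Y r s (X a) \<le> height X Y p q (X a)"
    proof (rule ccontr)
      assume "\<not> ?thesis"
      then have pq_rs: "height X Y p q (X a) < height X Y r s (X a)" by simp
      have rs_ab: "height X Y r s (X a) < height X Y a b (X a)" using rs by simp
      show False
      proof (cases "X s \<le> x")
        case True
        have "height X Y p q (X s) < height X Y r s (X s)"
          by (rule height_order_less[OF pq(1) _ _ _ _ rs(1), of "X a"])
            (use True pq_rs pq rs pa ab in auto)
        moreover have "height X Y r s (X s) < height X Y a b (X s)"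
          by (rule height_order_less[OF rs(1) _ _ _ _ ab(1), of "X a"])
            (use True rs_ab ab rs in auto)
        ultimately show False using L[of s] none sV True rs pa by force
      next
        case False
        have "height X Y p q x < height X Y r s x"
          by (rule height_order_less[OF pq(1) _ _ _ _ rs(1), of "X a"])
            (use False pq_rs pq rs pa ab in auto)
        moreover have "height X Y r s x < height X Y a b x"
          by (rule height_order_less[OF rs(1) _ _ _ _ ab(1), of "X a"])
            (use False rs_ab ab rs in auto)
        ultimately show False using first[OF rs(1)] False rs ab by force
      qed
    qed
  qed (use pq pa ab pq_a in auto)
qed

lemma overhang_right:
  assumes ab: "(a, b) \<in> T" "X a < x" "x < X b" and pq: "(p, q) \<in> T" "X p < x" "x < X q"
    and less: "height X Y p q x < height X Y a b x"
    and first: "\<And>r s. \<lbrakk>(r, s) \<in> T; X r < x; x < X s; height X Y r s x < height X Y a b x\<rbrakk> \<Longrightarrow>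
      height X Y r s x \<le> height X Y p q x"
    and none: "\<not> (\<exists>v\<in>V. lowest_above X Y T a b v)"
  shows "X b \<le> X q" and "X b < X q \<Longrightarrow> lowest_above X (\<lambda>v. - Y v) T p q b"
proof -
  interpret m: maximal_line_drawing V "\<lambda>v. - X v" Y T by (rule maximal_mirror)
  interpret r: maximal_line_drawing V X "\<lambda>v. - Y v" T by (rule maximal_reflect)
  have first': "height (\<lambda>v. - X v) Y r s (- x) \<le> height (\<lambda>v. - X v) Y q p (- x)"
    if "(r, s) \<in> T" "- X r < - x" "- x < - X s"
      "height (\<lambda>v. - X v) Y r s (- x) < height (\<lambda>v. - X v) Y b a (- x)" for r s
    using that first[of s r] ab pq by (simp add: sym_T height_sym)
  have "\<not> (\<exists>v\<in>V. lowest_above (\<lambda>v. - X v) Y T b a v)"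
    using none by (simp add: lowest_above_mirror)
  note O = m.overhang_left[of b a "- x" q p, OF _ _ _ _ _ _ _ first' this]
  have "- X q \<le> - X b"
    by (rule O(1)) (use ab pq less sym_T in \<open>auto simp: height_sym\<close>)
  then show "X b \<le> X q" by simp
  assume "X b < X q"
  then have "lowest_above (\<lambda>v. - X v) (\<lambda>v. - Y v) T q p b"
    by (intro O(2)) (use ab pq less sym_T in \<open>auto simp: height_sym\<close>)
  then show "lowest_above X (\<lambda>v. - Y v) T p q b" by (simp add: r.lowest_above_mirror)
qed

text \<open>The pair that is lowest over a point \<open>x\<close> just to the right of \<open>a\<close> is a hull edge; no edge can cross it,
so it belongs to \<open>T\<close>.\<close>

lemma lowest_pair_below_edge:
  assumes ab: "(a, b) \<in> T" "X a < X b" and u: "u \<in> V" "Y u < height X Y a b (X u)"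
  obtains x r s where "X a < x" "x < X b" "(r, s) \<in> T" "X r < x" "x < X s"
    "height X Y r s x < height X Y a b x"
proof -
  have V: "a \<in> V" "b \<in> V" using edgeD[OF ab(1)] by auto
  define R where "R = X ` {v \<in> V. X a < X v}"
  have R: "finite R" "X b \<in> R" using finite_V V ab by (auto simp: R_def)
  \<comment> \<open>The midpoint between \<open>a\<close> and the next larger x-coordinate, so that
    no vertex lies over \<open>x\<close>.\<close>
  define x where "x = (X a + Min R) / 2"
  have "X a < Min R" using R by (subst Min_gr_iff) (auto simp: R_def)
  then have ax: "X a < x" and "x < Min R" by (auto simp: x_def)
  then have gap: "x < X v" if "v \<in> V" "X a < X v" for v
    using that Min_le[OF R(1), of "X v"] by (force simp: R_def)
  then have gap': "X v < x \<or> x < X v" if "v \<in> V" for v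
    using that ax by force
  have xb: "x < X b" using gap V ab by blast
  define P where "P = {(r, s). r \<in> V \<and> s \<in> V \<and> X r < x \<and> x < X s}"
  define h where "h rs = height X Y (fst rs) (snd rs) x" for rs
  have "P \<subseteq> V \<times> V" "P \<noteq> {}" using V ax xb by (auto simp: P_def)
  then have finP: "finite P" using finite_subset[of P "V \<times> V"] finite_V by auto
  obtain m where m: "m \<in> P" and lowest_m: "\<And>rs. rs \<in> P \<Longrightarrow> h m \<le> h rs"
    using finite_argmin[OF finP \<open>P \<noteq> {}\<close>, of h] by blast
  \<comment> \<open>Several collinear pairs may be lowest; a shortest one has no vertex in its
    interior.\<close>
  define P' where "P' = {rs \<in> P. h rs = h m}"
  define w where "w rs = X (snd rs) - X (fst rs)" for rs
  have "finite P'" "m \<in> P'" using finP m by (simp_all add: P'_def)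
  then obtain rs where rs: "rs \<in> P'" and shortest: "\<And>rs'. rs' \<in> P' \<Longrightarrow> w rs \<le> w rs'"
    using finite_argmin[of P' w] by blast
  obtain r s where [simp]: "rs = (r, s)" by fastforce
  have V': "r \<in> V" "s \<in> V" and xrs: "X r < x" "x < X s" and hrs: "h (r, s) = h m"
    using rs by (auto simp: P'_def P_def)
  have lowest: "height X Y r s x \<le> height X Y r' s' x"
    if "r' \<in> V" "s' \<in> V" "X r' < x" "x < X s'" for r' s'
    using lowest_m[of "(r', s')"] that hrs by (simp add: P_def h_def)
  have shortest': "X s - X r \<le> X s' - X r'"
    if "r' \<in> V" "s' \<in> V" "X r' < x" "x < X s'" "height X Y r' s' x = height X Y r s x" for r' s'
    using shortest[of "(r', s')"] that hrs by (simp add: P'_def P_def w_def h_def)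
  \<comment> \<open>If \<open>v\<close> were below the line, replacing the endpoint on its side of
    \<open>x\<close> by \<open>v\<close> would give a lower pair.\<close>
  have hull: "height X Y r s (X v) \<le> Y v" if "v \<in> V" for v
  proof (rule ccontr)
    assume *: "\<not> ?thesis"
    show False
    proof (cases "X v < x")
      case True
      have "height X Y v s x < height X Y r s x"
        by (rule height_less_ray[of _ _ _ _ "X s" _ _ "X v"]) (use * xrs True in auto)
      then show False using lowest[of v s] that V' True xrs by simp
    next
      case False
      then have xv: "x < X v" using gap' that by blast
      have "height X Y r v x < height X Y r s x"
        by (rule height_less_ray[of _ _ _ _ "X r" _ _ "X v"]) (use * xrs xv in auto)
      then show False using lowest[of r v] that V' xv xrs by simp
    qed
  qed
  have between: False
    if v: "v \<in> V" "X r < X v" "X v < X s" and eq: "height X Y r s (X v) = Y v" for v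
  proof (cases "X v < x")
    case True
    obtain k where k: "\<And>y. height X Y v s y - height X Y r s y = k * (y - X v)"
      using height_diff_affine[of X Y v s r s "X v"] eq by auto
    then have "k = 0" using k[of "X s"] v xrs by simp
    then show False using shortest'[of v s] k[of x] v V' True xrs by simp
  next
    case False
    then have xv: "x < X v" using gap' v by blast
    obtain k where k: "\<And>y. height X Y r v y - height X Y r s y = k * (y - X v)"
      using height_diff_affine[of X Y r v r s "X v"] eq v by auto
    then have "k = 0" using k[of "X r"] v xrs by simp
    then show False using shortest'[of r v] k[of x] v V' xv xrs by simp
  qed
  have "(r, s) \<in> T"
  proof (rule maximal[OF V'])
    fix c d y
    assume cd: "(c, d) \<in> T" "X c < X d" and y: "X r \<le> y" "y \<le> X s" "X c \<le> y" "y \<le> X d"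
      and eq: "height X Y r s y = height X Y c d y"
    have V'': "c \<in> V" "d \<in> V" using edgeD[OF cd(1)] by auto
    obtain k where k: "\<And>z. height X Y c d z - height X Y r s z = k * (z - y)"
      using height_diff_affine[of X Y c d r s y] eq by auto
    have on_line: "v = r \<or> v = s" if "v \<in> V" "X r \<le> X v" "X v \<le> X s" "height X Y r s (X v) = Y v" for v
      using between[OF that(1) _ _ that(4)] that X_eqD[OF _ that(1) V'(1)] X_eqD[OF _ that(1) V'(2)]
      by force
    show "r = c \<and> s = d \<or> (\<exists>v\<in>{r, s} \<inter> {c, d}. y = X v)"
    proof (cases "y = X c \<or> y = X d")
      case True
      then show ?thesis using on_line[of c] on_line[of d] V'' eq y cd by auto
    next
      case False
      then have y': "X c < y" "y < X d" using y by auto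
      \<comment> \<open>Both ends of \<open>cd\<close> lie on or above the hull line, and
        \<open>cd\<close> meets that line in its interior, so the two lines coincide.\<close>
      have "k * (X c - y) \<ge> 0" "k * (X d - y) \<ge> 0"
        using k[of "X c"] k[of "X d"] hull V'' cd by (metis height_left height_right diff_ge_0_iff_ge less_imp_neq)+
      then have "k = 0" using y' by (auto simp: zero_le_mult_iff)
      then have same: "height X Y c d z = height X Y r s z" for z using k[of z] by simp
      have "\<not> (X r < X c \<and> X c < X s)" "\<not> (X r < X d \<and> X d < X s)"
        using between[of c] between[of d] V'' same[of "X c"] same[of "X d"] cd by auto
      moreover have "\<not> (X c < X r \<and> X r < X d)" "\<not> (X c < X s \<and> X s < X d)"
        using avoid[OF cd(1) V'(1)] avoid[OF cd(1) V'(2)] same[of "X r"] same[of "X s"] xrs by auto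
      ultimately have "X r = X c" "X s = X d" using y y' by linarith+
      then show ?thesis using X_eqD V' V'' by blast
    qed
  qed (use xrs between in auto)
  \<comment> \<open>Replacing \<open>a\<close> or \<open>b\<close> by the vertex \<open>u\<close>
    tilts the pair below \<open>ab\<close> over \<open>x\<close>, and \<open>rs\<close> is at most
    that high.\<close>
  moreover have "height X Y r s x < height X Y a b x"
  proof (cases "X a < X u")
    case True
    then have "x < X u" using gap u by blast
    have "height X Y a u x < height X Y a b x"
      by (rule height_less_ray[of _ _ _ _ "X a" _ _ "X u"]) (use True u ax in auto)
    then show ?thesis using lowest[of a u] V u ax \<open>x < X u\<close> by simp
  next
    case False
    have ub: "X u < x" using False ax by simp
    have "height X Y u b x < height X Y a b x"
      by (rule height_less_ray[of _ _ _ _ "X b" _ _ "X u"]) (use ub u xb ab in auto)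
    then show ?thesis using lowest[of u b] V u ub xb by simp
  qed
  ultimately show ?thesis using that ax xb xrs by blast
qed

text \<open>The face below \<open>ab\<close> has its middle vertex below \<open>ab\<close>, at \<open>a\<close>, or at \<open>b\<close>.\<close>

lemma lower_side:
  assumes ab: "(a, b) \<in> T" "X a < X b" and u: "u \<in> V" "Y u < height X Y a b (X u)"
  shows "(\<exists>v\<in>V. lowest_above X Y T a b v) \<or> (\<exists>p. lowest_above X (\<lambda>v. - Y v) T p b a) \<or>
    (\<exists>q. lowest_above X (\<lambda>v. - Y v) T a q b)"
proof (cases "\<exists>v\<in>V. lowest_above X Y T a b v")
  case none: False
  interpret r: maximal_line_drawing V X "\<lambda>v. - Y v" T by (rule maximal_reflect)
  obtain x r s where ax: "X a < x" and xb: "x < X b" and rs: "(r, s) \<in> T" "X r < x" "x < X s"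
    "height X Y r s x < height X Y a b x"
    using lowest_pair_below_edge[OF assms] by blast
  define R where "R = {(r, s). (r, s) \<in> T \<and> X r < x \<and> x < X s \<and> height X Y r s x < height X Y a b x}"
  define h where "h rs = height X Y (fst rs) (snd rs) x" for rs
  have "R \<subseteq> T" "R \<noteq> {}" using rs by (auto simp: R_def)
  then have "finite R" using finite_T finite_subset by blast
  then obtain pq where pq': "pq \<in> R" and highest: "\<And>rs. rs \<in> R \<Longrightarrow> h rs \<le> h pq"
    using finite_argmax[of R h] \<open>R \<noteq> {}\<close> by blast
  obtain p q where [simp]: "pq = (p, q)" by fastforce
  have pq: "(p, q) \<in> T" "X p < x" "x < X q" and less: "height X Y p q x < height X Y a b x"
    using pq' by (auto simp: R_def)
  have first: "height X Y r s x \<le> height X Y p q x"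
    if "(r, s) \<in> T" "X r < x" "x < X s" "height X Y r s x < height X Y a b x" for r s
    using highest[of "(r, s)"] that by (simp add: R_def h_def)
  note left = overhang_left[OF ab(1) ax xb pq less first none]
  note right = overhang_right[OF ab(1) ax xb pq less first none]
  have V: "a \<in> V" "b \<in> V" "p \<in> V" "q \<in> V" using edgeD ab pq by blast+
  \<comment> \<open>With overhang on both sides, \<open>a\<close> and \<open>b\<close> would be two
    middle vertices on the same side of \<open>pq\<close>. Overhang on one side gives a triangle,
    and without overhang \<open>pq\<close> would be \<open>ab\<close> itself.\<close>
  consider "X p < X a" "X b < X q" | "X p < X a" "X b = X q" | "X p = X a" "X b < X q"
    | "X p = X a" "X b = X q"
    using left(1) right(1) by linarith
  then show ?thesis
  proof cases
    case 1
    then show ?thesis using r.lowest_above_unique left(2) right(2) V ab by blast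
  next
    case 2
    then show ?thesis using left(2) X_eqD V by blast
  next
    case 3
    then show ?thesis using right(2) X_eqD V by blast
  next
    case 4
    then show ?thesis using X_eqD[of p a] X_eqD[of b q] V less by simp
  qed
qed simp

end

text \<open>There are only finitely many drawings on \<open>V\<close>, so an inclusion-maximal one
  contains \<open>T\<close>. An admissible pair missing from it could be added in both
  orientations.\<close>

lemma (in line_drawing) maximal_extension:
  obtains T' where "T \<subseteq> T'" "maximal_line_drawing V X Y T'"
proof -
  have "finite {T'. line_drawing V X Y T'}"
    by (rule finite_subset[of _ "Pow (V \<times> V)"]) (auto dest: line_drawing.T_V intro: finite_V)
  moreover have "T \<in> {T'. line_drawing V X Y T'}" using line_drawing_axioms by simp
  ultimately obtain T' where "T \<subseteq> T'" and T': "line_drawing V X Y T'"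
    and top: "\<And>S. line_drawing V X Y S \<Longrightarrow> T' \<subseteq> S \<Longrightarrow> T' = S"
    using finite_has_maximal2[of "{T'. line_drawing V X Y T'}" T] by auto
  interpret t: line_drawing V X Y T' by (rule T')
  have "maximal_line_drawing V X Y T'"
  proof
    fix p q
    assume pq: "p \<in> V" "q \<in> V" "X p < X q"
      and av: "\<And>w. \<lbrakk>w \<in> V; X p < X w; X w < X q\<rbrakk> \<Longrightarrow> height X Y p q (X w) \<noteq> Y w"
      and nc: "\<And>r s x. \<lbrakk>(r, s) \<in> T'; X r < X s; X p \<le> x; x \<le> X q; X r \<le> x; x \<le> X s;
          height X Y p q x = height X Y r s x\<rbrakk>
        \<Longrightarrow> p = r \<and> q = s \<or> (\<exists>c\<in>{p, q} \<inter> {r, s}. x = X c)"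
    have "line_drawing V X Y (insert (p, q) (insert (q, p) T'))"
    proof
      fix a b c d x
      assume A: "(a, b) \<in> insert (p, q) (insert (q, p) T')" "(c, d) \<in> insert (p, q) (insert (q, p) T')"
        "X a < X b" "X c < X d" "X a \<le> x" "x \<le> X b" "X c \<le> x" "x \<le> X d"
        "height X Y a b x = height X Y c d x"
      then consider "(a, b) \<in> T'" "(c, d) \<in> T'" | "(a, b) \<in> T'" "c = p" "d = q"
        | "a = p" "b = q" "(c, d) \<in> T'" | "a = c" "b = d"
        using pq by auto
      then show "a = c \<and> b = d \<or> (\<exists>v\<in>{a, b} \<inter> {c, d}. x = X v)"
      proof cases
        case 1
        then show ?thesis using t.noncrossing A by blast
      next
        case 2
        then have "p = a \<and> q = b \<or> (\<exists>v\<in>{p, q} \<inter> {a, b}. x = X v)"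
          by (intro nc) (use A in auto)
        then show ?thesis using 2 by auto
      next
        case 3
        then show ?thesis using nc[of c d x] A by auto
      qed simp
    qed (use t.finite_V t.inj_X t.T_V t.irrefl_T t.sym_T t.avoid pq av in auto)
    from top[OF this] show "(p, q) \<in> T'" by blast
  qed
  then show ?thesis using that \<open>T \<subseteq> T'\<close> by blast
qed

section \<open>Counting sides of edges\<close>

text \<open>The condition \<open>X a < X b\<close> counts each edge once. Upper sides are obtained
  by negating \<open>Y\<close>.\<close>

definition inner_below :: "'a set \<Rightarrow> ('a \<Rightarrow> real) \<Rightarrow> ('a \<Rightarrow> real) \<Rightarrow> ('a \<times> 'a) set \<Rightarrow> ('a \<times> 'a) set" where
  "inner_below V X Y E = {(a, b) \<in> E. X a < X b \<and> (\<exists>u\<in>V. Y u < height X Y a b (X u))}"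

definition outer_below :: "'a set \<Rightarrow> ('a \<Rightarrow> real) \<Rightarrow> ('a \<Rightarrow> real) \<Rightarrow> ('a \<times> 'a) set \<Rightarrow> ('a \<times> 'a) set" where
  "outer_below V X Y E = {(a, b) \<in> E. X a < X b \<and> (\<forall>u\<in>V. height X Y a b (X u) \<le> Y u)}"

text \<open>The complement in \<open>V\<close> is the set of vertices on the upper hull, including
  those in the interior of a hull edge; negating \<open>Y\<close> gives the lower hull.\<close>

definition covered :: "'a set \<Rightarrow> ('a \<Rightarrow> real) \<Rightarrow> ('a \<Rightarrow> real) \<Rightarrow> 'a set" where
  "covered V X Y = {v \<in> V. \<exists>r\<in>V. \<exists>s\<in>V. X r < X v \<and> X v < X s \<and> Y v < height X Y r s (X v)}"

text \<open>By \<open>lower_side\<close> and its reflection, every inner side faces a triangle. Each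
  covered vertex is the middle of at most one triangle per direction, and \<open>G\<close> contains
  at most two edges of a triangle.\<close>

lemma (in maximal_line_drawing) card_inner_sides_le:
  assumes G: "G \<subseteq> T" and no_triangle: "\<And>p q r. (p, q) \<in> G \<Longrightarrow> (q, r) \<in> G \<Longrightarrow> (p, r) \<notin> G"
  shows "card (inner_below V X Y G) + card (inner_below V X (\<lambda>v. - Y v) G)
    \<le> 2 * card (covered V X Y) + 2 * card (covered V X (\<lambda>v. - Y v))"
proof -
  interpret r: maximal_line_drawing V X "\<lambda>v. - Y v" T by (rule maximal_reflect)
  \<comment> \<open>\<open>(e, False)\<close> and \<open>(e, True)\<close> stand for the lower and the upper side of \<open>e\<close>; \<open>F Z c v\<close> collects
    the sides that face into the triangle with middle vertex \<open>v\<close>.\<close>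
  define F where "F Z c v = G \<times> UNIV \<inter> (\<Union>(p, q) \<in> {(p, q). lowest_above X Z T p q v}.
    {((p, q), c), ((p, v), \<not> c), ((v, q), \<not> c)})" for Z and c :: bool and v
  have F_le: "card (F Z c v) \<le> 2" and finite_F: "finite (F Z c v)"
    if "Z = Y \<or> Z = (\<lambda>v. - Y v)" "v \<in> V" for Z c v
  proof -
    have uniq: "p = p' \<and> q = q'" if "lowest_above X Z T p q v" "lowest_above X Z T p' q' v" for p q p' q'
      using lowest_above_fun[of p q v p' q'] r.lowest_above_fun[of p q v p' q'] that
        \<open>Z = Y \<or> Z = (\<lambda>v. - Y v)\<close> \<open>v \<in> V\<close> by blast
    have "card (F Z c v) \<le> 2 \<and> finite (F Z c v)"
    proof (cases "\<exists>p q. lowest_above X Z T p q v")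
      case True
      then obtain p q where pq: "lowest_above X Z T p q v" by blast
      have "{(p, q). lowest_above X Z T p q v} = {(p, q)}" using uniq pq by blast
      then have F: "F Z c v = G \<times> UNIV \<inter> {((p, q), c), ((p, v), \<not> c), ((v, q), \<not> c)}"
        by (simp add: F_def)
      have "\<exists>x y. F Z c v \<subseteq> {x, y}"
        using no_triangle[of p v q] unfolding F by blast
      then obtain x y where "F Z c v \<subseteq> {x, y}" by blast
      then show ?thesis
        using card_mono[of "{x, y}" "F Z c v"] card_insert_le_m1[of 2 "{y}" x]
        by (auto intro: finite_subset[of _ "{x, y}"])
    next
      case False
      then have "F Z c v = {}" by (simp add: F_def)
      then show ?thesis by simp
    qed
    then show "card (F Z c v) \<le> 2" "finite (F Z c v)" by auto
  qed
  define A B where "A = covered V X Y" and "B = covered V X (\<lambda>v. - Y v)"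
  have AB: "finite A" "finite B" "A \<subseteq> V" "B \<subseteq> V"
    using finite_V by (auto simp: A_def B_def covered_def)
  have inA: "v \<in> A" if "lowest_above X Y T p q v" "v \<in> V" for p q v
    using that edgeD[of p q] unfolding A_def covered_def lowest_above_def by blast
  have inB: "v \<in> B" if "lowest_above X (\<lambda>v. - Y v) T p q v" "v \<in> V" for p q v
    using that edgeD[of p q] unfolding B_def covered_def lowest_above_def by blast
  have inF: "lowest_above X Z T a b v \<Longrightarrow> (a, b) \<in> G \<Longrightarrow> ((a, b), c) \<in> F Z c v"
    "lowest_above X Z T p b a \<Longrightarrow> (a, b) \<in> G \<Longrightarrow> ((a, b), \<not> c) \<in> F Z c a"
    "lowest_above X Z T a q b \<Longrightarrow> (a, b) \<in> G \<Longrightarrow> ((a, b), \<not> c) \<in> F Z c b" for Z a b p q v c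
    unfolding F_def by blast+
  define I J where "I = inner_below V X Y G" and "J = inner_below V X (\<lambda>v. - Y v) G"
  let ?U = "(\<Union>v\<in>A. F Y False v) \<union> (\<Union>v\<in>B. F (\<lambda>v. - Y v) True v)"
  have "I \<times> {False} \<subseteq> ?U"
  proof
    fix e assume "e \<in> I \<times> {False}"
    then obtain a b u where e: "e = ((a, b), False)" "(a, b) \<in> G" "X a < X b" "u \<in> V"
      "Y u < height X Y a b (X u)"
      by (auto simp: I_def inner_below_def)
    then have "(a, b) \<in> T" using G by blast
    then have "a \<in> V" "b \<in> V" using edgeD by auto
    from lower_side[OF \<open>(a, b) \<in> T\<close> e(3,4,5)] show "e \<in> ?U"
    proof (elim disjE bexE exE)
      fix v assume "v \<in> V" "lowest_above X Y T a b v"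
      then show ?thesis using inA inF(1)[of Y a b v False] e by blast
    next
      fix p assume "lowest_above X (\<lambda>v. - Y v) T p b a"
      then show ?thesis using inB \<open>a \<in> V\<close> inF(2)[of "\<lambda>v. - Y v" p b a True] e by auto
    next
      fix q assume "lowest_above X (\<lambda>v. - Y v) T a q b"
      then show ?thesis using inB \<open>b \<in> V\<close> inF(3)[of "\<lambda>v. - Y v" a q b True] e by auto
    qed
  qed
  moreover have "J \<times> {True} \<subseteq> ?U"
  proof
    fix e assume "e \<in> J \<times> {True}"
    then obtain a b u where e: "e = ((a, b), True)" "(a, b) \<in> G" "X a < X b" "u \<in> V"
      "- Y u < height X (\<lambda>v. - Y v) a b (X u)"
      by (auto simp: J_def inner_below_def)
    then have "(a, b) \<in> T" using G by blast
    then have "a \<in> V" "b \<in> V" using edgeD by auto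
    from r.lower_side[OF \<open>(a, b) \<in> T\<close> e(3,4,5), unfolded minus_minus] show "e \<in> ?U"
    proof (elim disjE bexE exE)
      fix v assume "v \<in> V" "lowest_above X (\<lambda>v. - Y v) T a b v"
      then show ?thesis using inB inF(1)[of "\<lambda>v. - Y v" a b v True] e by blast
    next
      fix p assume "lowest_above X Y T p b a"
      then show ?thesis using inA \<open>a \<in> V\<close> inF(2)[of Y p b a False] e by auto
    next
      fix q assume "lowest_above X Y T a q b"
      then show ?thesis using inA \<open>b \<in> V\<close> inF(3)[of Y a q b False] e by auto
    qed
  qed
  moreover have "finite ?U" using AB finite_F by blast
  ultimately have "card (I \<times> {False} \<union> J \<times> {True}) \<le> card ?U" by (intro card_mono) auto
  moreover have "card (I \<times> {False} \<union> J \<times> {True}) = card I + card J"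
  proof -
    have "G \<subseteq> V \<times> V" using G T_V by blast
    then have "I \<subseteq> V \<times> V" "J \<subseteq> V \<times> V" by (auto simp: I_def J_def inner_below_def)
    then have "finite I" "finite J" using finite_V finite_subset by blast+
    then show ?thesis by (subst card_Un_disjoint) (auto simp: card_cartesian_product)
  qed
  moreover have "card ?U \<le> (\<Sum>v\<in>A. card (F Y False v)) + (\<Sum>v\<in>B. card (F (\<lambda>v. - Y v) True v))"
    by (rule order_trans[OF card_Un_le add_mono]) (use AB card_UN_le in auto)
  moreover have "(\<Sum>v\<in>A. card (F Y False v)) \<le> (\<Sum>v\<in>A. 2)"
    by (rule sum_mono) (use F_le AB in blast)
  moreover have "(\<Sum>v\<in>B. card (F (\<lambda>v. - Y v) True v)) \<le> (\<Sum>v\<in>B. 2)"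
    by (rule sum_mono) (use F_le AB in blast)
  ultimately show ?thesis unfolding I_def J_def A_def B_def by simp
qed

text \<open>Each lower hull edge is charged to its left endpoint, a lower hull vertex. The rightmost
  vertex is never charged, which makes the inequality strict. Crossings are irrelevant here, so the
  bound applies to the union of two layers.\<close>

lemma card_outer_below_less:
  assumes V: "finite V" "V \<noteq> {}" "inj_on X V" and E: "E \<subseteq> V \<times> V"
    and avoid: "\<And>p q w. \<lbrakk>(p, q) \<in> E; w \<in> V; X p < X w; X w < X q\<rbrakk> \<Longrightarrow> height X Y p q (X w) \<noteq> Y w"
  shows "card (outer_below V X Y E) < card (V - covered V X (\<lambda>v. - Y v))"
proof -
  obtain R where R: "R \<in> V" and rightmost: "\<And>v. v \<in> V \<Longrightarrow> X v \<le> X R"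
    using finite_argmax[of V X] V(1,2) by blast
  define U where "U = V - covered V X (\<lambda>v. - Y v)"
  have "fst ` outer_below V X Y E \<subseteq> U - {R}"
  proof
    fix a assume "a \<in> fst ` outer_below V X Y E"
    then obtain b where ab: "(a, b) \<in> E" "X a < X b" and
      hull: "\<And>u. u \<in> V \<Longrightarrow> height X Y a b (X u) \<le> Y u"
      by (auto simp: outer_below_def)
    have "\<not> height X Y r s (X a) < Y a" if "r \<in> V" "s \<in> V" "X r < X a" "X a < X s" for r s
    proof
      assume "height X Y r s (X a) < Y a"
      then have "height X (\<lambda>v. - Y v) a b (X a) + 0 < height X (\<lambda>v. - Y v) r s (X a)" by simp
      from height_less_endpoint[OF that(3,4) this] show False
        using hull[of r] hull[of s] that by auto
    qed
    moreover have "a \<in> V" "a \<noteq> R" using ab E rightmost[of b] by auto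
    ultimately show "a \<in> U - {R}" by (auto simp: U_def covered_def)
  qed
  moreover have "inj_on fst (outer_below V X Y E)"
  proof (rule inj_onI)
    fix e e' assume e: "e \<in> outer_below V X Y E" "e' \<in> outer_below V X Y E" "fst e = fst e'"
    obtain a b b' where [simp]: "e = (a, b)" "e' = (a, b')" using e(3) by (cases e, cases e') auto
    \<comment> \<open>The edge to \<open>b'\<close> must pass strictly below \<open>b\<close>, and
      then \<open>b'\<close> lies below the line through \<open>a\<close> and
      \<open>b\<close>.\<close>
    have *: "\<not> X b < X b'" if "(a, b) \<in> outer_below V X Y E" "(a, b') \<in> outer_below V X Y E" for b b'
    proof
      assume less: "X b < X b'"
      have ab: "(a, b) \<in> E" "X a < X b" "(a, b') \<in> E" "X a < X b'" "b \<in> V" "b' \<in> V"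
        "height X Y a b (X b') \<le> Y b'" "height X Y a b' (X b) \<le> Y b"
        using that E by (auto simp: outer_below_def)
      have lt: "height X Y a b' (X b) < Y b" using ab avoid[of a b' b] less by force
      have "height X Y a b' (X b') < height X Y a b (X b')"
        by (rule height_less_extrapolate[of _ _ _ _ "X a" _ _ "X b"]) (use ab less lt in auto)
      then show False using ab by simp
    qed
    have "b \<in> V" "b' \<in> V" using e E by (auto simp: outer_below_def)
    moreover have "X b = X b'" using *[of b b'] *[of b' b] e by force
    ultimately show "e = e'" using V(3) by (auto dest: inj_onD)
  qed
  ultimately have "card (outer_below V X Y E) \<le> card (U - {R})"
    using V by (metis U_def card_image card_mono finite_Diff)
  also have "\<dots> < card U"
  proof (rule psubset_card_mono)
    have "R \<notin> covered V X (\<lambda>v. - Y v)" using rightmost by (force simp: covered_def)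
    then show "U - {R} \<subset> U" using R by (auto simp: U_def)
  qed (use V in \<open>simp add: U_def\<close>)
  finally show ?thesis unfolding U_def .
qed

text \<open>The leftmost and rightmost vertices count twice. A further vertex lies on one side of
  the line joining them, and that side contributes a third hull vertex.\<close>

lemma card_uncovered:
  assumes V: "finite V" "inj_on X V" "card V \<ge> 3"
  shows "card (V - covered V X Y) + card (V - covered V X (\<lambda>v. - Y v)) \<ge> 5"
proof -
  have "V \<noteq> {}" using V by auto
  obtain R where R: "R \<in> V" and rightmost: "\<And>v. v \<in> V \<Longrightarrow> X v \<le> X R"
    using finite_argmax[of V X] V(1) \<open>V \<noteq> {}\<close> by blast
  obtain L where L: "L \<in> V" and leftmost: "\<And>v. v \<in> V \<Longrightarrow> X L \<le> X v"
    using finite_argmin[of V X] V(1) \<open>V \<noteq> {}\<close> by blast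
  have ends: "{L, R} \<subseteq> V - covered V X Z" for Z
    using L R leftmost rightmost by (force simp: covered_def)
  have "card {L, R} \<le> 2" by (simp add: card_insert_if)
  then have "V - {L, R} \<noteq> {}"
    using V card_mono[of "{L, R}" V] by auto
  then obtain m where m: "m \<in> V" "m \<noteq> L" "m \<noteq> R" by auto
  have "X L < X m" "X m < X R"
    using m L R leftmost[of m] rightmost[of m] V(2) by (auto simp: order_less_le dest: inj_onD)
  then have LR: "X L < X R" by simp
  then have "card {L, R} = 2" by (auto simp: card_insert_if)
  then have two: "card (V - covered V X Z) \<ge> 2" for Z
    using card_mono[OF _ ends, of Z] V by auto
  have three: "card (V - covered V X Z) \<ge> 3"
    if Z: "v \<in> V" "v \<noteq> L" "v \<noteq> R" "height X Z L R (X v) \<le> Z v" for Z v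
  proof -
    \<comment> \<open>The vertical excess over the line through \<open>L\<close> and
      \<open>R\<close>. A segment passing above a vertex of maximal excess would have an endpoint of
      larger excess.\<close>
    define g where "g v = Z v - height X Z L R (X v)" for v
    have gLR: "g L = 0" "g R = 0" using LR by (auto simp: g_def)
    have "finite (V - {L, R})" "V - {L, R} \<noteq> {}" using V m by auto
    then obtain w where w: "w \<in> V - {L, R}" and top: "\<And>u. u \<in> V - {L, R} \<Longrightarrow> g u \<le> g w"
      using finite_argmax[of "V - {L, R}" g] by blast
    have "g w \<ge> 0" using top[of v] Z by (auto simp: g_def)
    then have top': "g u \<le> g w" if "u \<in> V" for u
      by (cases "u = L \<or> u = R") (use top[of u] that gLR in auto)
    have "w \<notin> covered V X Z"
    proof
      assume "w \<in> covered V X Z"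
      then obtain r s where rs: "r \<in> V" "s \<in> V" "X r < X w" "X w < X s" "Z w < height X Z r s (X w)"
        by (auto simp: covered_def)
      then show False
        using height_less_endpoint[of X r "X w" s Z L R "g w"] top'[of r] top'[of s]
        by (auto simp: g_def)
    qed
    then have "{w, L, R} \<subseteq> V - covered V X Z" using ends[of Z] w by auto
    moreover have "L \<noteq> R" using LR by auto
    then have "card {w, L, R} = 3" using w by auto
    ultimately show ?thesis using V card_mono by (metis finite_Diff)
  qed
  show ?thesis
  proof (cases "height X Y L R (X m) \<le> Y m")
    case True
    then show ?thesis using three[of m Y] m two[of "\<lambda>v. - Y v"] by simp
  next
    case False
    then show ?thesis using three[of m "\<lambda>v. - Y v"] m two[of Y] by simp
  qed
qed

lemma two_layers_card_le:
  assumes L0: "line_drawing V X Y G0" and L1: "line_drawing V X Y G1"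
    and no_triangle: "\<And>p q r. (p, q) \<in> G0 \<union> G1 \<Longrightarrow> (q, r) \<in> G0 \<union> G1 \<Longrightarrow> (p, r) \<notin> G0 \<union> G1"
    and V: "card V \<ge> 3"
  shows "2 * card {(a, b) \<in> G0 \<union> G1. X a < X b} + 17 \<le> 8 * card V"
proof -
  define E where "E = G0 \<union> G1"
  define A B where "A = covered V X Y" and "B = covered V X (\<lambda>v. - Y v)"
  have fin: "finite V" "inj_on X V" and EV: "E \<subseteq> V \<times> V"
    using L0 L1 unfolding line_drawing_def E_def by auto
  then have finE: "finite E" using finite_subset by blast
  have "V \<noteq> {}" using V by auto
  have inner: "card (inner_below V X Y G) + card (inner_below V X (\<lambda>v. - Y v) G) \<le> 2 * card A + 2 * card B"
    if G: "line_drawing V X Y G" "G \<subseteq> E" for G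
  proof -
    obtain T where T: "G \<subseteq> T" "maximal_line_drawing V X Y T"
      using line_drawing.maximal_extension[OF G(1)] .
    show ?thesis
      unfolding A_def B_def
    proof (rule maximal_line_drawing.card_inner_sides_le[OF T(2,1)])
      show "(p, r) \<notin> G" if "(p, q) \<in> G" "(q, r) \<in> G" for p q r
        using no_triangle[of p q r] G(2) that unfolding E_def by blast
    qed
  qed
  have inner_Un: "card (inner_below V X Z E) \<le> card (inner_below V X Z G0) + card (inner_below V X Z G1)" for Z
  proof -
    have "inner_below V X Z E = inner_below V X Z G0 \<union> inner_below V X Z G1"
      by (auto simp: inner_below_def E_def)
    then show ?thesis by (simp add: card_Un_le)
  qed
  have split: "card {(a, b) \<in> E. X a < X b} = card (inner_below V X Z E) + card (outer_below V X Z E)" for Z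
  proof -
    have "{(a, b) \<in> E. X a < X b} = inner_below V X Z E \<union> outer_below V X Z E"
      unfolding inner_below_def outer_below_def using not_le by blast
    moreover have "inner_below V X Z E \<inter> outer_below V X Z E = {}"
      by (auto simp: inner_below_def outer_below_def not_less)
    moreover have "finite (inner_below V X Z E)" "finite (outer_below V X Z E)"
      using finE by (auto intro: finite_subset[of _ E] simp: inner_below_def outer_below_def)
    ultimately show ?thesis by (simp add: card_Un_disjoint)
  qed
  have avoid: "height X Y p q (X w) \<noteq> Y w" if "(p, q) \<in> E" "w \<in> V" "X p < X w" "X w < X q" for p q w
    using that line_drawing.avoid[OF L0] line_drawing.avoid[OF L1] unfolding E_def by blast
  have "card (outer_below V X Y E) < card (V - B)"
    unfolding B_def using fin \<open>V \<noteq> {}\<close> EV avoid by (intro card_outer_below_less) auto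
  moreover have "card (outer_below V X (\<lambda>v. - Y v) E) < card (V - A)"
    using card_outer_below_less[of V X E "\<lambda>v. - Y v"] fin \<open>V \<noteq> {}\<close> EV avoid by (simp add: A_def)
  moreover have "A \<subseteq> V" "B \<subseteq> V" by (auto simp: A_def B_def covered_def)
  then have "card (V - A) + card A = card V" "card (V - B) + card B = card V"
    using fin by (simp_all add: card_Diff_subset card_mono finite_subset)
  moreover have "card (V - A) + card (V - B) \<ge> 5"
    using card_uncovered[OF fin V] by (simp add: A_def B_def)
  \<comment> \<open>Let \<open>s\<close> be the sum of the two hull counts. The inner sides of both
    layers number at most \<open>4 * (2 * card V - s)\<close> and the outer sides at most
    \<open>s - 2\<close>. The total is at most \<open>8 * card V - 3 * s - 2\<close>, and
    \<open>s \<ge> 5\<close> gives the constant 17.\<close>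
  ultimately show ?thesis
    using inner[OF L0] inner[OF L1] inner_Un[of Y] inner_Un[of "\<lambda>v. - Y v"]
      split[of Y] split[of "\<lambda>v. - Y v"]
    by (simp add: E_def)
qed

section \<open>From the plane to coordinates\<close>

text \<open>Two points with different second coordinates are identified by exactly one value of
  \<open>e\<close>, and points with equal second coordinates by none. Finitely many values are
  therefore bad.\<close>

lemma generic_shear:
  fixes P :: "'a \<Rightarrow> real^2"
  assumes "finite V" "inj_on P V"
  obtains e where "inj_on (\<lambda>v. P v $ 1 + e * P v $ 2) V"
proof -
  define bad where "bad = (\<lambda>(v, w). (P v $ 1 - P w $ 1) / (P w $ 2 - P v $ 2)) ` (V \<times> V)"
  have "finite bad" using assms by (simp add: bad_def)
  then obtain e where e: "e \<notin> bad" using ex_new_if_finite infinite_UNIV_char_0 by blast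
  have "inj_on (\<lambda>v. P v $ 1 + e * P v $ 2) V"
  proof (rule inj_onI)
    fix v w assume vw: "v \<in> V" "w \<in> V" "P v $ 1 + e * P v $ 2 = P w $ 1 + e * P w $ 2"
    have "P v $ 2 = P w $ 2"
    proof (rule ccontr)
      assume "P v $ 2 \<noteq> P w $ 2"
      then have "e = (P v $ 1 - P w $ 1) / (P w $ 2 - P v $ 2)" using vw by (simp add: field_simps)
      then show False using e vw by (auto simp: bad_def)
    qed
    then have "P v = P w" using vw by (simp add: vec_eq_iff forall_2)
    then show "v = w" using assms vw by (auto dest: inj_onD)
  qed
  then show ?thesis using that by blast
qed

lemma edge_segment_point:
  fixes P :: "'a \<Rightarrow> real^2" and e :: real
  defines "X \<equiv> \<lambda>v. P v $ 1 + e * P v $ 2" and "Y \<equiv> \<lambda>v. P v $ 2"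
  assumes "X u < X v" "X u \<le> x" "x \<le> X v"
  obtains z where "z \<in> edge_segment P {u, v}" "z $ 1 + e * z $ 2 = x" "z $ 2 = height X Y u v x"
proof
  define t where "t = (x - X u) / (X v - X u)"
  have t: "0 \<le> t" "t \<le> 1" using assms(3-) by (auto simp: t_def)
  let ?z = "(1 - t) *\<^sub>R P u + t *\<^sub>R P v"
  show "?z \<in> edge_segment P {u, v}"
    using t by (auto simp: edge_segment_def segment_convex_hull[symmetric] closed_segment_def)
  have "?z $ 1 + e * ?z $ 2 = X u + t * (X v - X u)"
    by (simp add: X_def algebra_simps)
  also have "\<dots> = x" using assms(3) by (simp add: t_def)
  finally show "?z $ 1 + e * ?z $ 2 = x" .
  have "?z $ 2 = Y u + t * (Y v - Y u)" by (simp add: Y_def algebra_simps)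
  then show "?z $ 2 = height X Y u v x" by (simp add: height_def t_def)
qed

text \<open>A point of the plane is determined by its sheared first coordinate and its second
  coordinate, so equal heights over the same \<open>x\<close> mean a common point of the
  segments.\<close>

lemma layer_line_drawing:
  fixes P :: "'a \<Rightarrow> real^2" and e :: real
  defines "X \<equiv> \<lambda>v. P v $ 1 + e * P v $ 2" and "Y \<equiv> \<lambda>v. P v $ 2"
  assumes V: "finite V" "inj_on X V"
    and F: "\<And>u v. {u, v} \<in> F \<Longrightarrow> u \<in> V \<and> v \<in> V \<and> u \<noteq> v"
    and av: "\<And>f w. f \<in> F \<Longrightarrow> w \<in> V \<Longrightarrow> w \<notin> f \<Longrightarrow> P w \<notin> edge_segment P f"
    and nc: "\<And>f g. f \<in> F \<Longrightarrow> g \<in> F \<Longrightarrow> f \<noteq> g \<Longrightarrow> edge_segment P f \<inter> edge_segment P g \<subseteq> P ` (f \<inter> g)"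
  shows "line_drawing V X Y {(u, v). {u, v} \<in> F}"
proof
  fix p q w assume pq: "(p, q) \<in> {(u, v). {u, v} \<in> F}" and w: "w \<in> V" "X p < X w" "X w < X q"
  show "height X Y p q (X w) \<noteq> Y w"
  proof
    assume eq: "height X Y p q (X w) = Y w"
    obtain z where z: "z \<in> edge_segment P {p, q}" "z $ 1 + e * z $ 2 = X w" "z $ 2 = height X Y p q (X w)"
      using edge_segment_point[of P p e q "X w"] w unfolding X_def Y_def by auto
    have "z = P w" using z(2,3) eq by (simp add: vec_eq_iff forall_2 X_def Y_def)
    then show False using av[of "{p, q}" w] z(1) pq w by auto
  qed
next
  fix p q r s x
  assume pq: "(p, q) \<in> {(u, v). {u, v} \<in> F}" and rs: "(r, s) \<in> {(u, v). {u, v} \<in> F}"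
    and ord: "X p < X q" "X r < X s" and x: "X p \<le> x" "x \<le> X q" "X r \<le> x" "x \<le> X s"
    and eq: "height X Y p q x = height X Y r s x"
  show "p = r \<and> q = s \<or> (\<exists>c\<in>{p, q} \<inter> {r, s}. x = X c)"
  proof (cases "{p, q} = {r, s}")
    case True
    then show ?thesis using ord by (auto simp: doubleton_eq_iff)
  next
    case False
    obtain z where z: "z \<in> edge_segment P {p, q}" "z $ 1 + e * z $ 2 = x" "z $ 2 = height X Y p q x"
      using edge_segment_point[of P p e q x] ord x unfolding X_def Y_def by auto
    obtain z' where z': "z' \<in> edge_segment P {r, s}" "z' $ 1 + e * z' $ 2 = x" "z' $ 2 = height X Y r s x"
      using edge_segment_point[of P r e s x] ord x unfolding X_def Y_def by auto
    have "z = z'" using z(2,3) z'(2,3) eq by (simp add: vec_eq_iff forall_2)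
    then have "z \<in> P ` ({p, q} \<inter> {r, s})"
      using nc[of "{p, q}" "{r, s}"] False pq rs z(1) z'(1) by auto
    then obtain c where "c \<in> {p, q} \<inter> {r, s}" "z = P c" by blast
    moreover from this have "x = X c" using z(2) by (simp add: X_def)
    ultimately show ?thesis by blast
  qed
next
  show "(p, p) \<notin> {(u, v). {u, v} \<in> F}" for p using F[of p p] by blast
qed (use V F in \<open>auto simp: insert_commute\<close>)

section \<open>The graph $K_{6,8}$\<close>

lemma Kmn_edges_iff:
  "{u, v} \<in> Kmn_edges m n \<longleftrightarrow>
    (\<exists>i<m. \<exists>j<n. u = Inl i \<and> v = Inr j \<or> u = Inr j \<and> v = Inl i)"
  by (auto simp: Kmn_edges_def doubleton_eq_iff)

lemma card_Kmn_vertices: "card (Kmn_vertices m n) = m + n"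
  unfolding Kmn_vertices_def
  by (subst card_Un_disjoint) (auto simp: card_image inj_on_def)

lemma card_oriented_Kmn_edges:
  fixes X :: "nat + nat \<Rightarrow> real"
  assumes "inj_on X (Kmn_vertices m n)"
  shows "card {(u, v). {u, v} \<in> Kmn_edges m n \<and> X u < X v} = m * n"
proof -
  define f where "f = (\<lambda>(i, j). if X (Inl i) < X (Inr j) then (Inl i :: nat + nat, Inr j :: nat + nat)
    else (Inr j, Inl i))"
  have neq: "X (Inl i) \<noteq> X (Inr j)" if "i < m" "j < n" for i j
    using assms that by (auto simp: Kmn_vertices_def inj_on_def)
  have "{(u, v). {u, v} \<in> Kmn_edges m n \<and> X u < X v} = f ` ({..<m} \<times> {..<n})"
  proof (intro set_eqI iffI)
    fix e assume "e \<in> {(u, v). {u, v} \<in> Kmn_edges m n \<and> X u < X v}"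
    then obtain i j where "i < m" "j < n" "e = f (i, j)"
      by (auto simp: Kmn_edges_iff f_def)
    then show "e \<in> f ` ({..<m} \<times> {..<n})" by auto
  next
    fix e assume "e \<in> f ` ({..<m} \<times> {..<n})"
    then obtain i j where ij: "i < m" "j < n" "e = f (i, j)" by auto
    then show "e \<in> {(u, v). {u, v} \<in> Kmn_edges m n \<and> X u < X v}"
      using neq[of i j] by (auto simp: Kmn_edges_iff f_def)
  qed
  moreover have "inj_on f ({..<m} \<times> {..<n})"
    by (auto simp: inj_on_def f_def split: if_splits)
  ultimately show ?thesis by (simp add: card_image)
qed

section \<open>The lower bound\<close>

lemma K68_not_two_layers:
  assumes "k < 3"
  shows "\<not> has_geometric_layering (Kmn_vertices 6 8) (Kmn_edges 6 8) k"
proof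
  define V E where "V = Kmn_vertices 6 8" and "E = Kmn_edges 6 8"
  assume "has_geometric_layering (Kmn_vertices 6 8) (Kmn_edges 6 8) k"
  then obtain P :: "nat + nat \<Rightarrow> real^2" and c :: "(nat + nat) set \<Rightarrow> nat" where
    "inj_on P V \<and> (\<forall>e\<in>E. \<forall>w\<in>V. w \<notin> e \<longrightarrow> P w \<notin> edge_segment P e) \<and> (\<forall>e\<in>E. c e < k) \<and>
      (\<forall>e\<in>E. \<forall>f\<in>E. e \<noteq> f \<and> c e = c f \<longrightarrow> edge_segment P e \<inter> edge_segment P f \<subseteq> P ` (e \<inter> f))"
    unfolding has_geometric_layering_def V_def E_def by (elim exE)
  then have inj: "inj_on P V"
    and av: "\<And>e w. e \<in> E \<Longrightarrow> w \<in> V \<Longrightarrow> w \<notin> e \<Longrightarrow> P w \<notin> edge_segment P e"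
    and col: "\<And>e. e \<in> E \<Longrightarrow> c e < k"
    and nc: "\<And>e f. e \<in> E \<Longrightarrow> f \<in> E \<Longrightarrow> e \<noteq> f \<Longrightarrow> c e = c f \<Longrightarrow>
      edge_segment P e \<inter> edge_segment P f \<subseteq> P ` (e \<inter> f)"
    by simp_all
  have finV: "finite V" by (simp add: V_def Kmn_vertices_def)
  obtain e where e: "inj_on (\<lambda>v. P v $ 1 + e * P v $ 2) V"
    using generic_shear[OF finV inj] .
  define X Y where "X v = P v $ 1 + e * P v $ 2" and "Y v = P v $ 2" for v
  have "inj_on X V" using e by (simp add: X_def[abs_def])
  define G where "G i = {(u, v). {u, v} \<in> {e \<in> E. c e = i}}" for i
  have E: "u \<in> V \<and> v \<in> V \<and> u \<noteq> v" if "{u, v} \<in> E" for u v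
    using that by (auto simp: E_def V_def Kmn_edges_iff Kmn_vertices_def)
  have layer: "line_drawing V X Y (G i)" for i
    unfolding G_def X_def[abs_def] Y_def[abs_def]
    by (rule layer_line_drawing) (use finV e E av nc in auto)
  have G: "G 0 \<union> G 1 = {(u, v). {u, v} \<in> E}"
  proof -
    have "c e = 0 \<or> c e = 1" if "e \<in> E" for e using col[OF that] assms by auto
    then show ?thesis by (auto simp: G_def)
  qed
  have "2 * card {(a, b) \<in> G 0 \<union> G 1. X a < X b} + 17 \<le> 8 * card V"
  proof (rule two_layers_card_le[OF layer layer])
    show "(p, r) \<notin> G 0 \<union> G 1" if "(p, q) \<in> G 0 \<union> G 1" "(q, r) \<in> G 0 \<union> G 1" for p q r
      using that unfolding G by (auto simp: E_def Kmn_edges_iff)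
    show "3 \<le> card V" by (simp add: V_def card_Kmn_vertices)
  qed
  moreover have "card {(a, b) \<in> G 0 \<union> G 1. X a < X b} = 48"
    using card_oriented_Kmn_edges[of X 6 8] \<open>inj_on X V\<close> unfolding G by (simp add: E_def V_def)
  \<comment> \<open>The count fails by exactly one: \<open>2 * 48 + 17 = 113\<close>, while
    \<open>8 * 14 = 112\<close>.\<close>
  ultimately show False by (simp add: V_def card_Kmn_vertices)
qed

section \<open>The drawing with three layers\<close>

lemma K68_three_layers: "has_geometric_layering (Kmn_vertices 6 8) (Kmn_edges 6 8) 3"
proof -
  \<comment> \<open>Centres alternate between height 1 and -1, so \<open>i div 2\<close> puts one
    centre above and one below the axis into each layer.\<close>
  define P :: "nat + nat \<Rightarrow> real^2" where
    "P v = (case v of Inl i \<Rightarrow> vector [real i, (- 1) ^ i] | Inr j \<Rightarrow> vector [real j, 0])" for v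
  define c where "c e = (THE i. Inl i \<in> e) div 2" for e :: "(nat + nat) set"
  have P1: "P (Inl i) $ 1 = real i" "P (Inr j) $ 1 = real j"
    and P2: "P (Inl i) $ 2 = (- 1) ^ i" "P (Inr j) $ 2 = 0" for i j
    by (simp_all add: P_def)
  have c: "c {Inl i, Inr j} = i div 2" for i j by (simp add: c_def)
  have seg: "\<exists>t\<in>{0..1}. z $ 1 = real i + t * (real j - real i) \<and> z $ 2 = (1 - t) * (- 1) ^ i
      \<and> (t = 0 \<longrightarrow> z = P (Inl i)) \<and> (t = 1 \<longrightarrow> z = P (Inr j))"
    if z: "z \<in> edge_segment P {Inl i, Inr j}" for z i j
  proof -
    from z obtain t where t: "0 \<le> t" "t \<le> 1" "z = (1 - t) *\<^sub>R P (Inl i) + t *\<^sub>R P (Inr j)"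
      by (auto simp: edge_segment_def segment_convex_hull[symmetric] closed_segment_def)
    have "z $ 1 = real i + t * (real j - real i)" "z $ 2 = (1 - t) * (- 1) ^ i"
      by (simp_all add: t(3) P1 P2 algebra_simps)
    moreover have "t = 0 \<longrightarrow> z = P (Inl i)" "t = 1 \<longrightarrow> z = P (Inr j)"
      by (simp_all add: t(3))
    ultimately show ?thesis using t(1,2) by (intro bexI[of _ t]) simp_all
  qed
  have sign: "(- 1 :: real) ^ i = 1 \<or> (- 1 :: real) ^ i = - 1" for i
    by (cases "even i") auto
  have "inj_on P (Kmn_vertices 6 8)"
  proof (rule inj_onI)
    fix u v assume "P u = P v"
    then have "P u $ 1 = P v $ 1" "P u $ 2 = P v $ 2" by simp_all
    then show "u = v" by (cases u; cases v) (auto simp: P1 P2)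
  qed
  moreover have "P w \<notin> edge_segment P e" if "e \<in> Kmn_edges 6 8" "w \<notin> e" for e w
  proof
    assume w: "P w \<in> edge_segment P e"
    obtain i j where e: "e = {Inl i, Inr j}" using \<open>e \<in> _\<close> by (auto simp: Kmn_edges_def)
    obtain t where t: "t \<in> {0..1}" "P w $ 1 = real i + t * (real j - real i)" "P w $ 2 = (1 - t) * (- 1) ^ i"
      using seg[OF w[unfolded e]] by blast
    \<comment> \<open>Vertices have second coordinate 0, 1 or -1, values taken by an edge only at
      its ends.\<close>
    have "t = 0 \<or> t = 1"
    proof -
      have "P w $ 2 = 0 \<or> P w $ 2 = 1 \<or> P w $ 2 = - 1" using sign by (cases w) (auto simp: P2)
      then show ?thesis using t(1,3) sign[of i] by auto
    qed
    then show False
    proof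
      assume "t = 0"
      then show False using t that e by (cases w) (auto simp: P1 P2)
    next
      assume "t = 1"
      then show False using t that e by (cases w) (auto simp: P1 P2)
    qed
  qed
  moreover have "c e < 3" if "e \<in> Kmn_edges 6 8" for e
    using that by (auto simp: Kmn_edges_def c)
  moreover have "edge_segment P e \<inter> edge_segment P f \<subseteq> P ` (e \<inter> f)"
    if ef: "e \<in> Kmn_edges 6 8" "f \<in> Kmn_edges 6 8" "e \<noteq> f" "c e = c f" for e f
  proof
    fix z assume z: "z \<in> edge_segment P e \<inter> edge_segment P f"
    obtain i j where e: "e = {Inl i, Inr j}" using ef by (auto simp: Kmn_edges_def)
    obtain i' j' where f: "f = {Inl i', Inr j'}" using ef by (auto simp: Kmn_edges_def)
    obtain t where t: "t \<in> {0..1}" "z $ 1 = real i + t * (real j - real i)" "z $ 2 = (1 - t) * (- 1) ^ i"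
      "t = 0 \<Longrightarrow> z = P (Inl i)" "t = 1 \<Longrightarrow> z = P (Inr j)"
      using seg[of z i j] z e by auto
    obtain t' where t': "t' \<in> {0..1}" "z $ 1 = real i' + t' * (real j' - real i')"
      "z $ 2 = (1 - t') * (- 1) ^ i'" "t' = 1 \<Longrightarrow> z = P (Inr j')"
      using seg[of z i' j'] z f by auto
    show "z \<in> P ` (e \<inter> f)"
    \<comment> \<open>Edges with a common centre have equal parameters at equal height, and their
      different ends force \<open>t = 0\<close>. Edges with different centres lie on opposite sides
      of the axis and can meet only on it, at their ends.\<close>
    proof (cases "i = i'")
      case True
      then have "t = t'" using t(3) t'(3) by simp
      moreover have "j \<noteq> j'" using ef True e f by auto
      ultimately have "t = 0" using t(2) t'(2) True by auto
      then show ?thesis using t(4) e f True by auto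
    next
      case False
      have "i div 2 = i' div 2" using ef by (simp add: e f c)
      then have "even i \<longleftrightarrow> odd i'" using False by presburger
      then have "(- 1 :: real) ^ i' = - ((- 1) ^ i)" by (cases "even i") auto
      then have "((1 - t) + (1 - t')) * (- 1) ^ i = 0" using t(3) t'(3) by (simp add: algebra_simps)
      then have "t = 1" "t' = 1" using t(1) t'(1) by auto
      then have z: "z = P (Inr j)" "z = P (Inr j')" using t(5) t'(4) by blast+
      then have "real j = real j'" using P1(2) by metis
      then show ?thesis using e f z(1) by simp
    qed
  qed
  ultimately show ?thesis
    unfolding has_geometric_layering_def by (intro exI[of _ P] exI[of _ c]) blast
qed

theorem theorem5p3:
  shows "geometric_thickness (Kmn_vertices 6 8) (Kmn_edges 6 8) = 3"
  unfolding geometric_thickness_def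
proof (rule Least_equality)
  fix k assume "has_geometric_layering (Kmn_vertices 6 8) (Kmn_edges 6 8) k"
  then show "3 \<le> k" using K68_not_two_layers[of k] by force
qed (rule K68_three_layers)

end
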